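(* Let $\varepsilon>0$ be given, consider the saddle point problem $$\psi^*:=\min_{x\in X}\Big\{\psi(x):=f(x)+\max_{y\in Y}\langle Kx,y\rangle-J(y)\Big\}$$ where $f$ is strongly convex with modulus $\mu>0$ and has Lipschitz constant $L$, and suppose that $L$ satisfies $$\Omega\|K\|^2\max\left\{\sqrt{\frac{15\Delta_0}{\varepsilon}},1\right\}\ge 2\omega\Delta_0L.$$ Also assume that the prox-function $V$ grows quadratically, i.e. $V(x,u)\le\frac12\|x-u\|^2$ for all $x,u\in X$. If the parameters of the multi-stage AGS algorithm with dynamic smoothing are set to $$N_0=3\sqrt{\frac{2L}{\nu\mu}},\qquad S=\log_2\max\left\{\frac{15\Delta_0}{\varepsilon},1\right\},\qquad\text{and}\qquad \rho_0=\frac{4\Delta_0}{\Omega 2^{S/2}},$$ then the output $v_S$ of this algorithm must be an $\varepsilon$-solution of the saddle point problem. Moreover, the total number of gradient evaluations of $\nabla f$ and operator evaluations involving $K$ and $K^T$ performed by the algorithm can be bounded by $$N_f:=3\sqrt{\frac{2L}{\nu\mu}}\log_2\max\left\{\frac{15\Delta_0}{\varepsilon},1\right\}$$ and $$N_K:=18\sqrt{\frac{L}{\nu\mu}}\log_2\max\left\{\frac{15\Delta_0}{\varepsilon},1\right\}+\frac{56\sqrt{\Omega}\,\|K\|}{\sqrt{\mu\Delta_0\nu\omega}}\cdot\max\left\{\sqrt{\frac{15\Delta_0}{\varepsilon}},1\right\},$$ respectively.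
   Context: Setting. $\mathbb{R}^n$ and $\mathbb{R}^m$ carry norms (both written $\|\cdot\|$) and inner products $\langle\cdot,\cdot\rangle$. $X\subseteq\mathbb{R}^n$, $Y\subseteq\mathbb{R}^m$ are closed convex sets; $K:\mathbb{R}^n\to\mathbb{R}^m$ is a linear operator with operator norm $\|K\|=\max\{\langle Kx,y\rangle:\|x\|\le1,\|y\|\le1\}$; $J$ is a relatively simple convex function. $f:X\to\mathbb{R}$ is continuously differentiable and convex, and $L,\mu>0$ satisfy, with $l_f(u,x):=f(u)+\langle\nabla f(u),x-u\rangle$, $$\tfrac{\mu}{2}\|x-u\|^2\le f(x)-l_f(u,x)\le\tfrac{L}{2}\|x-u\|^2,\qquad\forall x,u\in X.$$ An $\varepsilon$-solution of the saddle point problem is a point $\bar x\in X$ with $\psi(\bar x)-\psi^*\le\varepsilon$. Prox-functions. A prox-function on a set $Z$ with modulus $\sigma>0$ is $D(z,u)=\pi(u)-\pi(z)-\langle\nabla\pi(z),u-z\rangle$, $z,u\in Z$, for some (differentiable) $\pi$ strongly convex with parameter $\sigma$ with respect to the given norm; so $D(z,u)\ge\frac{\sigma}{2}\|z-u\|^2$. $V$ is a prox-function on $X$ with modulus $\nu$ and $W$ a prox-function on $Y$ with modulus $\omega$. $Y$ is assumed bounded, in the sense that there is $y_0\in Y$ for which $\Omega:=\max_{v\in Y}W(y_0,v)$ is finite. Smoothing. For $\rho>0$, $h_\rho(x):=\max_{y\in Y}\langle Kx,y\rangle-J(y)-\rho W(y_0,y)$, a convex differentiable function, and $\psi_\rho:=f+h_\rho$.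 Known fact (Nesterov): with $M=\|K\|^2/(\rho\omega)$, $0\le h_\rho(x)-l_{h_\rho}(u,x)\le\frac{M}{2}\|x-u\|^2$ for all $x,u\in X$, where $l_h(u,x):=h(u)+\langle\nabla h(u),x-u\rangle$, and $\nabla h_\rho(x)=K^Ty^*(x)$ with $y^*(x)$ the maximizer. AGS (accelerated gradient sliding) algorithm (for $\min_{x\in X}f(x)+h(x)$). Choose $x_0\in X$ and set $\overline{x}_0=x_0$. For $k=1,\dots,N$: $$\underline{x}_k=(1-\gamma_k)\overline{x}_{k-1}+\gamma_kx_{k-1},\quad g_k(\cdot)=l_f(\underline{x}_k,\cdot),$$ $$(x_k,\tilde x_k)=\mathrm{ProxAG}(g_k,\overline{x}_{k-1},x_{k-1},\lambda_k,\beta_k,T_k),\quad \overline{x}_k=(1-\lambda_k)\overline{x}_{k-1}+\lambda_k\tilde x_k.$$ Output $\overline{x}_N$. Procedure $(x^+,\tilde x^+)=\mathrm{ProxAG}(g,\overline{x},x,\lambda,\beta,T)$: set $\tilde u_0=\overline{x}$, $u_0=x$. For $t=1,\dots,T$: $$\underline{u}_t=(1-\lambda)\overline{x}+\lambda(1-\alpha_t)\tilde u_{t-1}+\lambda\alpha_tu_{t-1},$$ $$u_t=\operatorname*{argmin}_{u\in X}\ g(u)+l_h(\underline{u}_t,u)+\beta V(x,u)+(\beta p_t+q_t)V(u_{t-1},u),$$ $$\tilde u_t=(1-\alpha_t)\tilde u_{t-1}+\alpha_tu_t.$$ Output $x^+=u_T$, $\tilde x^+=\tilde u_T$. AGS parameters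 used (with given $L$, $M$). In the first call to ProxAG ($k=1$): $\alpha_t=\frac{2}{t+1}$, $p_t=\frac{t-1}{2}$, $q_t=\frac{7LT_1(T_1+1)}{4\nu t}$. In the $k$-th call, $k>1$: $p_t\equiv p:=\sqrt{M/L}$, $\alpha_t\equiv\alpha:=\frac1{p+1}$, $q_t\equiv0$. Moreover $\gamma_k=\frac{2}{k+1}$; $T_1=\lceil\sqrt{8M/(7L)}\rceil$ and $T_k=\lceil\ln 3/(-\ln(1-\alpha))\rceil$ for $k>1$; $\lambda_1=1$ and $\lambda_k=\gamma_k/(1-(1-\alpha)^{T_k})$ for $k>1$; $\beta_1=L/\nu$ and $\beta_k=\frac{9L\gamma_k}{2\nu k\lambda_k}$ for $k>1$. Multi-stage AGS algorithm with dynamic smoothing. Choose $v_0\in X$, accuracy $\varepsilon$, smoothing parameter $\rho_0$, iteration limit $N_0$, and an initial estimate $\Delta_0$ such that $\psi(v_0)-\psi^*\le\Delta_0$. For $s=1,\dots,S$: run the AGS algorithm on $\min_{x\in X}f(x)+h_\rho(x)$ with $\rho=2^{-s/2}\rho_0$ (so $h=h_\rho$, $M=\|K\|^2/(\rho\omega)$), $x_0=v_{s-1}$, $N=N_0$ and the AGS parameters above, and let $v_s=\overline{x}_N$ be its output. Output $v_S$. Counting. Each outer iteration of AGS uses one evaluation of $\nabla f$; each inner iteration uses one evaluation of $\nabla h_\rho$ (and none of $\nabla f$), which costs two linear operator evaluations: one of $K$ and one of $K^T$.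
   Formalization: N_0 and S are iteration counts, so the algorithm is run with the stated values rounded up; the ε-solution claim holds always, the printed bounds N_f and N_K are proved when both values are integers, and otherwise with the rounded values inserted. *)

theory Defs
  imports "HOL-Analysis.Analysis"
begin

(* The type class norm of 'a is the one induced by the inner product; the norms of the
   problem are arbitrary and need not be Euclidean. *)
definition is_norm :: "('a::real_vector \<Rightarrow> real) \<Rightarrow> bool" where
  "is_norm n \<longleftrightarrow>
     (\<forall>x. n x = 0 \<longleftrightarrow> x = 0) \<and>
     (\<forall>c x. n (c *\<^sub>R x) = \<bar>c\<bar> * n x) \<and>
     (\<forall>x y. n (x + y) \<le> n x + n y)"

definition op_norm ::
  "('a \<Rightarrow> real) \<Rightarrow> ('b::real_inner \<Rightarrow> real) \<Rightarrow> ('a \<Rightarrow> 'b) \<Rightarrow> real" where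
  "op_norm nX nY K = Sup {K x \<bullet> y | x y. nX x \<le> 1 \<and> nY y \<le> 1}"

definition lin :: "('a::real_inner \<Rightarrow> real) \<Rightarrow> ('a \<Rightarrow> 'a) \<Rightarrow> 'a \<Rightarrow> 'a \<Rightarrow> real" where
  "lin f df u x = f u + df u \<bullet> (x - u)"

definition grad :: "('a::real_inner \<Rightarrow> real) \<Rightarrow> 'a \<Rightarrow> 'a" where
  "grad h x = (THE d. GDERIV h x :> d)"

(* Gradient of a function defined on the convex set X only; it need not be unique when X has
   empty interior, but its inner products with directions u - z (z, u in X) are. *)
definition has_gradient_on ::
  "('a::real_inner \<Rightarrow> real) \<Rightarrow> ('a \<Rightarrow> 'a) \<Rightarrow> 'a set \<Rightarrow> bool" where
  "has_gradient_on f df X \<longleftrightarrow>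
     (\<forall>x\<in>X. (f has_derivative (\<lambda>d. df x \<bullet> d)) (at x within X))"

definition strongly_convex_on ::
  "('a::real_vector \<Rightarrow> real) \<Rightarrow> 'a set \<Rightarrow> real \<Rightarrow> ('a \<Rightarrow> real) \<Rightarrow> bool" where
  "strongly_convex_on n Z \<sigma> \<phi> \<longleftrightarrow> convex Z \<and>
     (\<forall>x\<in>Z. \<forall>y\<in>Z. \<forall>t\<in>{0..1}.
        \<phi> ((1 - t) *\<^sub>R x + t *\<^sub>R y) \<le>
          (1 - t) * \<phi> x + t * \<phi> y - \<sigma> / 2 * t * (1 - t) * (n (x - y))\<^sup>2)"

definition prox_function ::
  "('a::real_inner \<Rightarrow> real) \<Rightarrow> 'a set \<Rightarrow> real \<Rightarrow> ('a \<Rightarrow> 'a \<Rightarrow> real) \<Rightarrow> bool" where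
  "prox_function n Z \<sigma> D \<longleftrightarrow> \<sigma> > 0 \<and>
     (\<exists>\<phi> d\<phi>. has_gradient_on \<phi> d\<phi> Z \<and> strongly_convex_on n Z \<sigma> \<phi> \<and>
        (\<forall>z\<in>Z. \<forall>u\<in>Z. D z u = \<phi> u - \<phi> z - d\<phi> z \<bullet> (u - z)))"

definition saddle_obj ::
  "('a \<Rightarrow> real) \<Rightarrow> ('a \<Rightarrow> 'b::real_inner) \<Rightarrow> ('b \<Rightarrow> real) \<Rightarrow> 'b set \<Rightarrow> 'a \<Rightarrow> real" where
  "saddle_obj f K J Y x = f x + (SUP y\<in>Y. K x \<bullet> y - J y)"

definition eps_solution :: "('a \<Rightarrow> real) \<Rightarrow> 'a set \<Rightarrow> real \<Rightarrow> 'a \<Rightarrow> bool" where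
  "eps_solution \<psi> X \<epsilon> x \<longleftrightarrow> x \<in> X \<and> \<psi> x - (INF z\<in>X. \<psi> z) \<le> \<epsilon>"

definition smoothed ::
  "('a \<Rightarrow> 'b::real_inner) \<Rightarrow> ('b \<Rightarrow> real) \<Rightarrow> 'b set \<Rightarrow> ('b \<Rightarrow> 'b \<Rightarrow> real) \<Rightarrow> 'b \<Rightarrow> real \<Rightarrow>
   'a \<Rightarrow> real" where
  "smoothed K J Y W y0 \<rho> x = (SUP y\<in>Y. K x \<bullet> y - J y - \<rho> * W y0 y)"


(* State after t inner iterations: (u_t, ut_t, number of evaluations of K and of its
   transpose).  The gradient of the smoothed function at w is the transpose of K applied to the
   maximizer for K w, so each inner iteration costs two operator evaluations. *)
primrec prox_ag ::
  "'a::real_inner set \<Rightarrow> ('a \<Rightarrow> 'a \<Rightarrow> real) \<Rightarrow> ('a \<Rightarrow> real) \<Rightarrow> (nat \<Rightarrow> real) \<Rightarrow> (nat \<Rightarrow> real) \<Rightarrow>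
   (nat \<Rightarrow> real) \<Rightarrow> ('a \<Rightarrow> real) \<Rightarrow> 'a \<Rightarrow> 'a \<Rightarrow> real \<Rightarrow> real \<Rightarrow> nat \<Rightarrow> 'a \<times> 'a \<times> nat" where
  "prox_ag X V h \<alpha> p q g xb x l \<beta> 0 = (x, xb, 0)"
| "prox_ag X V h \<alpha> p q g xb x l \<beta> (Suc t) =
     (let (u, ut, c) = prox_ag X V h \<alpha> p q g xb x l \<beta> t;
          a = \<alpha> (Suc t);
          w = (1 - l) *\<^sub>R xb + (l * (1 - a)) *\<^sub>R ut + (l * a) *\<^sub>R u;
          u' = arg_min_on (\<lambda>z. g z + lin h (grad h) w z + \<beta> * V x z
                               + (\<beta> * p (Suc t) + q (Suc t)) * V u z) X
      in (u', (1 - a) *\<^sub>R ut + a *\<^sub>R u', c + 2))"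


definition ags_alpha :: "real \<Rightarrow> real \<Rightarrow> nat \<Rightarrow> nat \<Rightarrow> real" where
  "ags_alpha L M k t = (if k = 1 then 2 / (real t + 1) else 1 / (sqrt (M / L) + 1))"

definition ags_p :: "real \<Rightarrow> real \<Rightarrow> nat \<Rightarrow> nat \<Rightarrow> real" where
  "ags_p L M k t = (if k = 1 then (real t - 1) / 2 else sqrt (M / L))"

(* For k > 1 the weight ags_alpha L M k t does not depend on t. *)
definition ags_T :: "real \<Rightarrow> real \<Rightarrow> nat \<Rightarrow> nat" where
  "ags_T L M k =
     (if k = 1 then nat \<lceil>sqrt (8 * M / (7 * L))\<rceil>
      else nat \<lceil>ln 3 / (- ln (1 - ags_alpha L M k 1))\<rceil>)"

definition ags_q :: "real \<Rightarrow> real \<Rightarrow> real \<Rightarrow> nat \<Rightarrow> nat \<Rightarrow> real" where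
  "ags_q L M \<nu> k t =
     (if k = 1 then 7 * L * real (ags_T L M 1) * (real (ags_T L M 1) + 1) / (4 * \<nu> * real t)
      else 0)"

definition ags_gamma :: "nat \<Rightarrow> real" where
  "ags_gamma k = 2 / (real k + 1)"

definition ags_lambda :: "real \<Rightarrow> real \<Rightarrow> nat \<Rightarrow> real" where
  "ags_lambda L M k =
     (if k = 1 then 1 else ags_gamma k / (1 - (1 - ags_alpha L M k 1) ^ ags_T L M k))"

definition ags_beta :: "real \<Rightarrow> real \<Rightarrow> real \<Rightarrow> nat \<Rightarrow> real" where
  "ags_beta L M \<nu> k =
     (if k = 1 then L / \<nu>
      else 9 * L * ags_gamma k / (2 * \<nu> * real k * ags_lambda L M k))"


(* State after k outer iterations: (x_k, xb_k, number of evaluations of the gradient df of f,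
   number of operator evaluations).  The linearization of f is formed once per outer iteration
   and reused by all inner ones. *)
primrec ags ::
  "'a::real_inner set \<Rightarrow> ('a \<Rightarrow> 'a \<Rightarrow> real) \<Rightarrow> ('a \<Rightarrow> real) \<Rightarrow> ('a \<Rightarrow> 'a) \<Rightarrow> ('a \<Rightarrow> real) \<Rightarrow>
   real \<Rightarrow> real \<Rightarrow> real \<Rightarrow> 'a \<Rightarrow> nat \<Rightarrow> 'a \<times> 'a \<times> nat \<times> nat" where
  "ags X V f df h L M \<nu> x0 0 = (x0, x0, 0, 0)"
| "ags X V f df h L M \<nu> x0 (Suc n) =
     (let (x, xb, cf, cK) = ags X V f df h L M \<nu> x0 n;
          k = Suc n;
          l = ags_lambda L M k;
          xl = (1 - ags_gamma k) *\<^sub>R xb + ags_gamma k *\<^sub>R x;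
          (x', xt, c) = prox_ag X V h (ags_alpha L M k) (ags_p L M k) (ags_q L M \<nu> k)
                          (lin f df xl) xb x l (ags_beta L M \<nu> k) (ags_T L M k)
      in (x', (1 - l) *\<^sub>R xb + l *\<^sub>R xt, cf + 1, cK + c))"


(* State after s stages: (v_s, number of evaluations of df, total number of operator
   evaluations).  hs \<rho> is the smoothed function and Ms \<rho> its smoothness constant. *)
primrec ms_ags ::
  "'a::real_inner set \<Rightarrow> ('a \<Rightarrow> 'a \<Rightarrow> real) \<Rightarrow> ('a \<Rightarrow> real) \<Rightarrow> ('a \<Rightarrow> 'a) \<Rightarrow>
   (real \<Rightarrow> 'a \<Rightarrow> real) \<Rightarrow> real \<Rightarrow> (real \<Rightarrow> real) \<Rightarrow> real \<Rightarrow> real \<Rightarrow> nat \<Rightarrow> 'a \<Rightarrow> nat \<Rightarrow>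
   'a \<times> nat \<times> nat" where
  "ms_ags X V f df hs L Ms \<nu> \<rho>0 N0 v0 0 = (v0, 0, 0)"
| "ms_ags X V f df hs L Ms \<nu> \<rho>0 N0 v0 (Suc n) =
     (let (v, cf, cK) = ms_ags X V f df hs L Ms \<nu> \<rho>0 N0 v0 n;
          \<rho> = 2 powr (- (real (Suc n) / 2)) * \<rho>0;
          (x, xb, df_evals, K_evals) = ags X V f df (hs \<rho>) L (Ms \<rho>) \<nu> v N0
      in (xb, cf + df_evals, cK + K_evals))"

end

(* Each stage minimizes f + h_rho by accelerated gradient sliding.  Along one call of ProxAG, the
   combination E_t of h at (1 - lambda) xb + lambda ut_t and the linearization of f at ut_t
   contracts by 1 - alpha_t up to Bregman terms that telescope.  Part of these terms is kept as
   |ut_t - Theta_t xb - (1 - Theta_t) x|^2, where Theta_t = (1 - alpha_1) ... (1 - alpha_t); it pays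
   for the quadratic error of the linearization of f.  The outer iterations then telescope to
     N (N + 1) (gap of the output) <= 9 L / nu * V(x0, u),
   and strong convexity together with V <= |.|^2 / 2 turns this into a halving of the gap as soon as
   N >= 3 sqrt (2 L / (nu mu)).  Since h_rho decreases in rho and changes by at most
   (change of rho) * Omega, the gap after stage s is at most Delta0 / 2^s + rho_s Omega, and the
   choice of rho0 makes the final gap at most 9 Delta0 / 2^S <= epsilon.
   If K or Omega vanishes, the condition on L forces Delta0 <= 0, so that no stage is run. *)
theory Submission
  imports Defs
begin

section \<open>Norms, coercivity and prox-functions\<close>

text \<open>Two smoothness errors have to be paid, that of \<open>h\<close> in every inner iteration
  and that of \<open>f\<close> in every outer one. Since the norms need not be Euclidean, the only
  means of payment are Bregman distances and convexity of the squared norm. The error of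
  \<open>h\<close> is paid at once by the distance between consecutive \<open>u\<close> points. The
  error of \<open>f\<close> lives at the averaged point, so the distances from \<open>x\<close> to
  all inner iterates are first merged by Cauchy-Schwarz into the square of a weighted average of the
  steps. The rule \<open>lambda_k * (1 - Theta_T) = gamma_k\<close> makes \<open>xb_k - xl_k\<close>
  exactly \<open>lambda_k\<close> times this average, which is why \<open>lambda_k\<close> has the
  form it has. Gaps are measured against every point of \<open>X\<close> and not against an infimum,
  which would be meaningless without a lower bound; the infimum enters only in the final theorem.
  The smoothed function with \<open>\<rho> = 0\<close> is the original max term, so monotonicity in
  \<open>\<rho>\<close> covers smoothing, the change of stage and the removal of the smoothing
  alike.\<close>

lemma is_norm_zero: "is_norm n \<Longrightarrow> n 0 = 0"
  by (simp add: is_norm_def)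

lemma is_norm_scale: "is_norm n \<Longrightarrow> n (c *\<^sub>R x) = \<bar>c\<bar> * n x"
  by (simp add: is_norm_def)

lemma is_norm_triangle: "is_norm n \<Longrightarrow> n (x + y) \<le> n x + n y"
  by (simp add: is_norm_def)

lemma is_norm_minus: "is_norm n \<Longrightarrow> n (- x) = n x"
  using is_norm_scale[of n "-1" x] by simp

lemma is_norm_minus_commute: "is_norm n \<Longrightarrow> n (x - y) = n (y - x)"
  using is_norm_minus[of n "x - y"] by simp

lemma is_norm_nonneg: "is_norm n \<Longrightarrow> 0 \<le> n x"
  using is_norm_triangle[of n x "- x"] by (simp add: is_norm_minus is_norm_zero)

text \<open>Together with the next lemma this is the equivalence of \<open>n\<close> and the
  Euclidean norm: limits and derivatives are Euclidean, whereas all estimates are in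
  \<open>n\<close>.\<close>

lemma is_norm_upper_bound:
  fixes n :: "'a::euclidean_space \<Rightarrow> real"
  assumes n: "is_norm n"
  obtains C where "C > 0" "\<And>x. n x \<le> C * norm x"
proof
  let ?C = "(\<Sum>b\<in>Basis. n b) + 1"
  have sum_nonneg: "0 \<le> (\<Sum>b\<in>(Basis::'a set). n b)"
    by (intro sum_nonneg is_norm_nonneg[OF n])
  then show "?C > 0" by simp
  fix x :: 'a
  have "n (\<Sum>b\<in>A. (x \<bullet> b) *\<^sub>R b) \<le> (\<Sum>b\<in>A. \<bar>x \<bullet> b\<bar> * n b)" if "finite A" for A
    using that
  proof (induction A)
    case empty
    then show ?case by (simp add: is_norm_zero[OF n])
  next
    case (insert b A)
    then show ?case
      using is_norm_triangle[OF n, of "(x \<bullet> b) *\<^sub>R b" "\<Sum>b\<in>A. (x \<bullet> b) *\<^sub>R b"]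
      by (simp add: is_norm_scale[OF n])
  qed
  from this[of Basis] have "n x \<le> (\<Sum>b\<in>Basis. \<bar>x \<bullet> b\<bar> * n b)"
    by (simp add: euclidean_representation)
  also have "\<dots> \<le> (\<Sum>b\<in>Basis. norm x * n b)"
    by (intro sum_mono mult_right_mono is_norm_nonneg[OF n] Basis_le_norm)
  also have "\<dots> \<le> ?C * norm x"
    by (simp add: sum_distrib_left[symmetric] algebra_simps)
  finally show "n x \<le> ?C * norm x" .
qed

text \<open>The upper bound makes \<open>n\<close> Lipschitz, so it attains a minimum on the compact
  Euclidean unit sphere. Definiteness makes this minimum positive, and homogeneity extends the bound
  to all vectors.\<close>

lemma is_norm_lower_bound:
  fixes n :: "'a::euclidean_space \<Rightarrow> real"
  assumes n: "is_norm n"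
  obtains c where "c > 0" "\<And>x. c * norm x \<le> n x"
proof -
  obtain C where C: "C > 0" "\<And>x. n x \<le> C * norm x"
    using is_norm_upper_bound[OF n] by blast
  have "\<bar>n x - n y\<bar> \<le> C * norm (x - y)" for x y
    using is_norm_triangle[OF n, of "x - y" y] is_norm_triangle[OF n, of "y - x" x]
      C(2)[of "x - y"] is_norm_minus_commute[OF n, of x y] by simp
  then have "C-lipschitz_on UNIV n"
    using C(1) by (auto simp: lipschitz_on_def dist_norm)
  then have cont: "continuous_on (sphere 0 1) n"
    using lipschitz_on_continuous_on continuous_on_subset by blast
  obtain b :: 'a where "b \<in> Basis" using nonempty_Basis by blast
  then have "sphere (0::'a) 1 \<noteq> {}" by (metis mem_sphere_0 norm_Basis empty_iff)
  from continuous_attains_inf[OF compact_sphere this cont]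
  obtain m where m: "norm m = 1" "\<And>y. norm y = 1 \<Longrightarrow> n m \<le> n y" by auto
  have "m \<noteq> 0" using m(1) by auto
  then have "n m \<noteq> 0" using n by (simp add: is_norm_def)
  then have pos: "n m > 0" using is_norm_nonneg[OF n, of m] by simp
  have "n m * norm x \<le> n x" for x
  proof (cases "x = 0")
    case True
    then show ?thesis by (simp add: is_norm_zero[OF n])
  next
    case False
    then have "n m \<le> n ((1 / norm x) *\<^sub>R x)" by (intro m(2)) simp
    also have "\<dots> = n x / norm x" by (simp add: is_norm_scale[OF n])
    finally show ?thesis using False by (simp add: field_simps)
  qed
  then show thesis using that pos by blast
qed

text \<open>\<open>op_norm\<close> is a \<open>Sup\<close> of reals, which carries information only
  for a set bounded above.\<close>

lemma bdd_above_op_norm: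
  fixes K :: "'a::euclidean_space \<Rightarrow> 'b::euclidean_space"
  assumes nX: "is_norm nX" and nY: "is_norm nY" and K: "linear K"
  shows "bdd_above {K x \<bullet> y | x y. nX x \<le> 1 \<and> nY y \<le> 1}"
proof -
  obtain c where c: "c > 0" "\<And>x. c * norm x \<le> nX x" using is_norm_lower_bound[OF nX] by blast
  obtain d where d: "d > 0" "\<And>y. d * norm y \<le> nY y" using is_norm_lower_bound[OF nY] by blast
  obtain B where B: "B > 0" "\<And>x. norm (K x) \<le> B * norm x" using linear_bounded_pos[OF K] by blast
  have "K x \<bullet> y \<le> B * (1 / c) * (1 / d)" if "nX x \<le> 1" "nY y \<le> 1" for x y
  proof -
    have x: "norm x \<le> 1 / c" using c(1) c(2)[of x] that by (simp add: field_simps)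
    have y: "norm y \<le> 1 / d" using d(1) d(2)[of y] that by (simp add: field_simps)
    have "K x \<bullet> y \<le> norm (K x) * norm y" by (rule norm_cauchy_schwarz)
    also have "\<dots> \<le> (B * norm x) * norm y" by (intro mult_right_mono B) simp
    also have "\<dots> \<le> (B * (1 / c)) * (1 / d)" using x y B(1) c(1) by (intro mult_mono) auto
    finally show ?thesis .
  qed
  then show ?thesis unfolding bdd_above_def by blast
qed

lemma op_norm_nonneg:
  fixes K :: "'a::euclidean_space \<Rightarrow> 'b::euclidean_space"
  assumes "is_norm nX" "is_norm nY" "linear K"
  shows "0 \<le> op_norm nX nY K"
proof -
  have "K 0 \<bullet> 0 \<in> {K x \<bullet> y | x y. nX x \<le> 1 \<and> nY y \<le> 1}"
    using is_norm_zero[OF assms(1)] is_norm_zero[OF assms(2)]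
    by (intro CollectI exI[of _ 0] conjI refl) auto
  from cSup_upper[OF this bdd_above_op_norm[OF assms]] show ?thesis by (simp add: op_norm_def)
qed

lemma op_norm_bound:
  fixes K :: "'a::euclidean_space \<Rightarrow> 'b::euclidean_space"
  assumes nX: "is_norm nX" and nY: "is_norm nY" and K: "linear K"
  shows "K x \<bullet> y \<le> op_norm nX nY K * nX x * nY y"
proof (cases "x = 0 \<or> y = 0")
  case True
  then show ?thesis using linear_0[OF K] is_norm_zero[OF nX] is_norm_zero[OF nY] by auto
next
  case False
  then have pos: "nX x > 0" "nY y > 0"
    using nX nY is_norm_nonneg[OF nX, of x] is_norm_nonneg[OF nY, of y]
    by (auto simp: is_norm_def order.strict_iff_order)
  let ?x = "(1 / nX x) *\<^sub>R x" and ?y = "(1 / nY y) *\<^sub>R y"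
  have "nX ?x \<le> 1" "nY ?y \<le> 1"
    using pos by (simp_all add: is_norm_scale[OF nX] is_norm_scale[OF nY])
  then have "K ?x \<bullet> ?y \<le> op_norm nX nY K"
    unfolding op_norm_def by (intro cSup_upper bdd_above_op_norm[OF assms]) blast
  then have "K ?x \<bullet> ?y * (nX x * nY y) \<le> op_norm nX nY K * (nX x * nY y)"
    using pos by (intro mult_right_mono) auto
  then show ?thesis using pos by (simp add: linear_scale[OF K] algebra_simps)
qed

section \<open>Existence of minimizers and first-order conditions on closed convex sets\<close>

lemma coercive_attains_min:
  fixes X :: "'a::euclidean_space set" and F :: "'a \<Rightarrow> real"
  assumes "closed X" and x0: "x0 \<in> X" and cont: "continuous_on X F" and n: "is_norm n"
    and "c > 0" and lower: "\<And>z. z \<in> X \<Longrightarrow> b + a \<bullet> (z - x0) + c * (n (z - x0))\<^sup>2 \<le> F z"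
  obtains m where "m \<in> X" "\<And>z. z \<in> X \<Longrightarrow> F m \<le> F z"
proof -
  obtain d where d: "d > 0" "\<And>x. d * norm x \<le> n x" using is_norm_lower_bound[OF n] by blast
  define e where "e = c * d\<^sup>2"
  have e: "e > 0" using \<open>c > 0\<close> d by (simp add: e_def)
  have lower': "b - norm a * norm (z - x0) + e * (norm (z - x0))\<^sup>2 \<le> F z" if "z \<in> X" for z
  proof -
    have "(d * norm (z - x0))\<^sup>2 \<le> (n (z - x0))\<^sup>2"
      using d by (intro power_mono) auto
    then have "e * (norm (z - x0))\<^sup>2 \<le> c * (n (z - x0))\<^sup>2"
      using \<open>c > 0\<close> by (simp add: e_def power_mult_distrib algebra_simps)
    moreover have "- (norm a * norm (z - x0)) \<le> a \<bullet> (z - x0)"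
      using Cauchy_Schwarz_ineq2[of a "z - x0"] by linarith
    ultimately show ?thesis using lower[OF that] by linarith
  qed
  \<comment> \<open>Beyond this radius \<open>e * r\<close> exceeds \<open>norm a\<close> plus the
    distance of \<open>F x0\<close> and \<open>b\<close>, so quadratic growth beats the linear term
    and \<open>F\<close> stays above \<open>F x0\<close>. The \<open>max\<close> with 1 gives
    \<open>r > 1\<close>, which allows a constant to be multiplied by \<open>r\<close>. The search
    is thus reduced to a compact set.\<close>
  define R where "R = max 1 ((norm a + \<bar>F x0 - b\<bar>) / e)"
  have far: "F x0 \<le> F z" if z: "z \<in> X" "z \<notin> cball x0 R" for z
  proof -
    define r where "r = norm (z - x0)"
    have "r > R" using z by (simp add: r_def dist_norm norm_minus_commute)
    then have r: "r > 1" "e * r > norm a + \<bar>F x0 - b\<bar>"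
      using e by (auto simp: R_def field_simps)
    have "\<bar>F x0 - b\<bar> * 1 \<le> \<bar>F x0 - b\<bar> * r" using r by (intro mult_left_mono) auto
    also have "\<dots> \<le> (e * r - norm a) * r" using r by (intro mult_right_mono) auto
    finally have "\<bar>F x0 - b\<bar> \<le> e * r\<^sup>2 - norm a * r" by (simp add: algebra_simps power2_eq_square)
    then show ?thesis using lower'[OF z(1)] by (simp add: r_def)
  qed
  have cpt: "compact (X \<inter> cball x0 R)" using \<open>closed X\<close> by (simp add: closed_Int_compact)
  have "x0 \<in> X \<inter> cball x0 R" using x0 by (simp add: R_def)
  then have "X \<inter> cball x0 R \<noteq> {}" by blast
  from continuous_attains_inf[OF cpt this continuous_on_subset[OF cont]]
  obtain m where m: "m \<in> X \<inter> cball x0 R" "\<And>z. z \<in> X \<inter> cball x0 R \<Longrightarrow> F m \<le> F z" by auto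
  have "F m \<le> F z" if "z \<in> X" for z
    using m(2)[of z] m(2)[OF \<open>x0 \<in> X \<inter> cball x0 R\<close>] far[of z] that by force
  then show thesis using that m(1) by blast
qed

text \<open>\<open>X\<close> may have empty interior, so derivatives are taken within
  \<open>X\<close> and tested only in directions between two of its points. Restriction to the
  segment makes them one-sided derivatives on the line.\<close>

lemma segment_derivative:
  fixes F :: "'a::real_normed_vector \<Rightarrow> real"
  assumes "convex X" "m \<in> X" "z \<in> X" and F: "(F has_derivative F') (at m within X)"
  shows "((\<lambda>t. (F (m + t *\<^sub>R (z - m)) - F m) / t) \<longlongrightarrow> F' (z - m)) (at_right (0::real))"
proof -
  let ?g = "\<lambda>t::real. m + t *\<^sub>R (z - m)"
  have g: "(?g has_derivative (\<lambda>t. t *\<^sub>R (z - m))) (at 0 within {0..1})"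
    by (auto intro!: derivative_eq_intros)
  have sub: "?g ` {0..1} \<subseteq> X"
  proof -
    have "?g t = (1 - t) *\<^sub>R m + t *\<^sub>R z" for t by (simp add: algebra_simps)
    then show ?thesis using assms by (auto intro!: convexD_alt)
  qed
  have "(F has_derivative F') (at (?g 0) within ?g ` {0..1})"
    using has_derivative_subset[OF F sub] by simp
  from diff_chain_within[OF g this]
  have "((\<lambda>t. F (?g t)) has_derivative (\<lambda>t. F' (t *\<^sub>R (z - m)))) (at 0 within {0..1})"
    by (simp add: o_def)
  moreover have "F' (t *\<^sub>R (z - m)) = F' (z - m) * t" for t
    using F by (simp add: has_derivative_def bounded_linear.linear linear_scale)
  ultimately have "((\<lambda>t. F (?g t)) has_field_derivative F' (z - m)) (at 0 within {0..1})"
    by (simp add: has_field_derivative_def)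
  then have "((\<lambda>t. (F (?g t) - F m) / t) \<longlongrightarrow> F' (z - m)) (at 0 within {0..1})"
    by (simp add: has_field_derivative_iff)
  then show ?thesis
    by (simp add: at_within_Icc_at_right)
qed

lemma min_variational_inequality:
  fixes F :: "'a::real_normed_vector \<Rightarrow> real"
  assumes "convex X" "m \<in> X" "z \<in> X" and F: "(F has_derivative F') (at m within X)"
    and min: "\<And>z. z \<in> X \<Longrightarrow> F m \<le> F z"
  shows "0 \<le> F' (z - m)"
proof (rule tendsto_lowerbound[OF segment_derivative[OF assms(1-4)]])
  have "0 \<le> (F (m + t *\<^sub>R (z - m)) - F m) / t" if "0 < t" "t < 1" for t
  proof -
    have "m + t *\<^sub>R (z - m) = (1 - t) *\<^sub>R m + t *\<^sub>R z" by (simp add: algebra_simps)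
    also have "\<dots> \<in> X" using assms that by (intro convexD_alt) auto
    finally show ?thesis using min that by simp
  qed
  then show "\<forall>\<^sub>F t in at_right 0. 0 \<le> (F (m + t *\<^sub>R (z - m)) - F m) / t"
    by (auto simp: eventually_at_right_field intro!: exI[of _ 1])
qed simp

section \<open>Bregman distances and the proximal step\<close>

lemma prox_function_lower_bound:
  fixes D :: "'a::real_inner \<Rightarrow> 'a \<Rightarrow> real"
  assumes D: "prox_function n Z \<sigma> D" and n: "is_norm n" and zu: "z \<in> Z" "u \<in> Z"
  shows "\<sigma> / 2 * (n (z - u))\<^sup>2 \<le> D z u"
proof -
  obtain \<phi> d\<phi> where \<phi>: "has_gradient_on \<phi> d\<phi> Z" "strongly_convex_on n Z \<sigma> \<phi>"
    and Deq: "D z u = \<phi> u - \<phi> z - d\<phi> z \<bullet> (u - z)"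
    using D zu unfolding prox_function_def by blast
  have cvx: "convex Z" using \<phi>(2) by (simp add: strongly_convex_on_def)
  have der: "(\<phi> has_derivative (\<lambda>d. d\<phi> z \<bullet> d)) (at z within Z)"
    using \<phi>(1) zu by (simp add: has_gradient_on_def)
  \<comment> \<open>Strong convexity at \<open>z + t (u - z)\<close>, divided by \<open>t\<close>,
    bounds the difference quotient by this function of \<open>t\<close>; in the limit the factor
    \<open>1 - t\<close> disappears.\<close>
  have lim: "((\<lambda>t::real. \<phi> u - \<phi> z - \<sigma> / 2 * (1 - t) * (n (z - u))\<^sup>2) \<longlongrightarrow>
      \<phi> u - \<phi> z - \<sigma> / 2 * (1 - 0) * (n (z - u))\<^sup>2) (at_right 0)"
    by (intro tendsto_intros)
  have "(\<phi> (z + t *\<^sub>R (u - z)) - \<phi> z) / t \<le> \<phi> u - \<phi> z - \<sigma> / 2 * (1 - t) * (n (z - u))\<^sup>2"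
    if "0 < t" "t < 1" for t
  proof -
    have "z + t *\<^sub>R (u - z) = (1 - t) *\<^sub>R z + t *\<^sub>R u" by (simp add: algebra_simps)
    then have "\<phi> (z + t *\<^sub>R (u - z)) \<le>
        (1 - t) * \<phi> z + t * \<phi> u - \<sigma> / 2 * t * (1 - t) * (n (z - u))\<^sup>2"
      using \<phi>(2) zu that by (simp add: strongly_convex_on_def)
    then have "\<phi> (z + t *\<^sub>R (u - z)) - \<phi> z \<le>
        t * (\<phi> u - \<phi> z - \<sigma> / 2 * (1 - t) * (n (z - u))\<^sup>2)" by (simp add: algebra_simps)
    then show ?thesis using that by (simp add: pos_divide_le_eq mult.commute)
  qed
  then have "\<forall>\<^sub>F t in at_right 0. (\<phi> (z + t *\<^sub>R (u - z)) - \<phi> z) / t \<le>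
      \<phi> u - \<phi> z - \<sigma> / 2 * (1 - t) * (n (z - u))\<^sup>2"
    by (auto simp: eventually_at_right_field intro!: exI[of _ 1])
  from tendsto_le[OF _ lim segment_derivative[OF cvx zu der] this]
  show ?thesis by (simp add: Deq)
qed

lemma prox_function_nonneg:
  fixes D :: "'a::real_inner \<Rightarrow> 'a \<Rightarrow> real"
  assumes "prox_function n Z \<sigma> D" "is_norm n" "z \<in> Z" "u \<in> Z"
  shows "0 \<le> D z u"
proof -
  have "0 \<le> \<sigma> / 2 * (n (z - u))\<^sup>2" using assms(1) by (simp add: prox_function_def)
  then show ?thesis using prox_function_lower_bound[OF assms] by linarith
qed

text \<open>Three-point inequality. On \<open>X\<close> the function \<open>F\<close> is
  \<open>(b + c) * \<phi>\<close> plus an affine function, so \<open>F z - F m\<close> is exactly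
  \<open>(b + c) * V m z\<close> plus the derivative at \<open>m\<close> in direction
  \<open>z - m\<close>, which is nonnegative by optimality.\<close>

lemma prox_step:
  fixes X :: "'a::euclidean_space set" and V :: "'a \<Rightarrow> 'a \<Rightarrow> real" and k :: "'a"
  assumes X: "closed X" and n: "is_norm n" and V: "prox_function n X \<nu> V"
    and x: "x \<in> X" and y: "y \<in> X" and b: "b > 0" and c: "c \<ge> 0"
    and l: "\<And>z. l z = r + k \<bullet> z"
  defines "F \<equiv> \<lambda>z. l z + b * V x z + c * V y z"
  defines "m \<equiv> arg_min_on F X"
  shows "m \<in> X"
    and "z \<in> X \<Longrightarrow> F m + (b + c) * V m z \<le> F z"
proof -
  obtain \<phi> d\<phi> where \<phi>: "has_gradient_on \<phi> d\<phi> X" "strongly_convex_on n X \<nu> \<phi>"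
    and Veq: "\<And>z u. z \<in> X \<Longrightarrow> u \<in> X \<Longrightarrow> V z u = \<phi> u - \<phi> z - d\<phi> z \<bullet> (u - z)"
    and \<nu>: "\<nu> > 0"
    using V unfolding prox_function_def by blast
  have cvx: "convex X" using \<phi>(2) by (simp add: strongly_convex_on_def)
  \<comment> \<open>\<open>V\<close> is tied to \<open>\<phi>\<close> only on \<open>X\<close>.
    \<open>G\<close> is the Bregman formula written out, with a computable derivative, and agrees
    with \<open>F\<close> on \<open>X\<close>.\<close>
  define G where "G z = l z + b * (\<phi> z - \<phi> x - d\<phi> x \<bullet> (z - x)) + c * (\<phi> z - \<phi> y - d\<phi> y \<bullet> (z - y))" for z
  have FG: "F z = G z" if "z \<in> X" for z
    using that x y by (simp add: F_def G_def Veq)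
  have der: "(G has_derivative (\<lambda>d. k \<bullet> d + b * (d\<phi> z \<bullet> d - d\<phi> x \<bullet> d) + c * (d\<phi> z \<bullet> d - d\<phi> y \<bullet> d)))
      (at z within X)" if "z \<in> X" for z
  proof -
    have "(\<phi> has_derivative (\<lambda>d. d\<phi> z \<bullet> d)) (at z within X)"
      using \<phi>(1) that by (simp add: has_gradient_on_def)
    then show ?thesis unfolding G_def l by (auto intro!: derivative_eq_intros)
  qed
  have "continuous_on X G"
    using der has_derivative_continuous continuous_on_eq_continuous_within by blast
  moreover have "r + k \<bullet> x + k \<bullet> (z - x) + b * \<nu> / 2 * (n (z - x))\<^sup>2 \<le> G z" if z: "z \<in> X" for z
  proof -
    have "b * (\<nu> / 2 * (n (x - z))\<^sup>2) \<le> b * V x z"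
      using prox_function_lower_bound[OF V n x z] b by (intro mult_left_mono) auto
    moreover have "0 \<le> c * V y z" using prox_function_nonneg[OF V n y z] c by simp
    ultimately show ?thesis using is_norm_minus_commute[OF n, of x z]
      by (simp add: FG[OF z, symmetric] F_def l inner_diff_right)
  qed
  moreover have "b * \<nu> / 2 > 0" using b \<nu> by simp
  ultimately obtain m' where "m' \<in> X" "\<And>z. z \<in> X \<Longrightarrow> G m' \<le> G z"
    using coercive_attains_min[OF X x _ n, of G "b * \<nu> / 2" "r + k \<bullet> x" k] by blast
  \<comment> \<open>\<open>arg_min_on\<close> chooses some minimizer; the existence of
    \<open>m'\<close> ensures that the chosen point \<open>m\<close> really is one.\<close>
  then have "is_arg_min F (\<lambda>z. z \<in> X) m'"
    by (force simp: is_arg_min_linorder FG)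
  then have "is_arg_min F (\<lambda>z. z \<in> X) m"
    unfolding m_def arg_min_on_def arg_min_def by (rule someI)
  then have m: "m \<in> X" "\<And>z. z \<in> X \<Longrightarrow> F m \<le> F z"
    by (auto simp: is_arg_min_linorder)
  show "m \<in> X" by fact
  assume z: "z \<in> X"
  have "0 \<le> k \<bullet> (z - m) + b * (d\<phi> m \<bullet> (z - m) - d\<phi> x \<bullet> (z - m))
      + c * (d\<phi> m \<bullet> (z - m) - d\<phi> y \<bullet> (z - m))"
    using m by (intro min_variational_inequality[OF cvx m(1) z der]) (auto simp: FG)
  then show "F m + (b + c) * V m z \<le> F z"
    using m z x y by (simp add: F_def l Veq inner_diff_right algebra_simps)
qed

section \<open>Accelerated gradient sliding\<close>

text \<open>Cauchy-Schwarz in Engel form. It merges the steps of the inner iterations into the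
  square of their average.\<close>

lemma square_sum_over_sum_le:
  fixes r s A B :: real
  assumes "A > 0" "B > 0"
  shows "(r + s)\<^sup>2 / (A + B) \<le> r\<^sup>2 / A + s\<^sup>2 / B"
proof -
  have "r\<^sup>2 / A + s\<^sup>2 / B - (r + s)\<^sup>2 / (A + B) = (r * B - s * A)\<^sup>2 / (A * B * (A + B))"
    using assms by (simp add: divide_simps power2_eq_square) (simp add: algebra_simps)
  also have "\<dots> \<ge> 0" using assms by simp
  finally show ?thesis by simp
qed

lemma lin_affine_comb: "lin f df u ((1 - t) *\<^sub>R x + t *\<^sub>R y) = (1 - t) * lin f df u x + t * lin f df u y"
  by (simp add: lin_def inner_diff_right inner_add_right algebra_simps)

lemma snd_snd_prox_ag: "snd (snd (prox_ag X V h \<alpha> p q g xb x l \<beta> t)) = 2 * t"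
  by (induction t) (simp_all add: Let_def case_prod_beta)

section \<open>Inner and outer iterations for general parameters\<close>

locale ags_setting =
  fixes X :: "'a::euclidean_space set" and n :: "'a \<Rightarrow> real" and V :: "'a \<Rightarrow> 'a \<Rightarrow> real"
    and f :: "'a \<Rightarrow> real" and df :: "'a \<Rightarrow> 'a" and h :: "'a \<Rightarrow> real" and L M \<nu> :: real
  assumes closed: "closed X" and cvx: "convex X" and n: "is_norm n" and V: "prox_function n X \<nu> V"
    and f_bounds: "x \<in> X \<Longrightarrow> u \<in> X \<Longrightarrow> lin f df u x \<le> f x"
      "x \<in> X \<Longrightarrow> u \<in> X \<Longrightarrow> f x \<le> lin f df u x + L / 2 * (n (x - u))\<^sup>2"
    and h_bounds: "x \<in> X \<Longrightarrow> u \<in> X \<Longrightarrow> lin h (grad h) u x \<le> h x"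
      "x \<in> X \<Longrightarrow> u \<in> X \<Longrightarrow> h x \<le> lin h (grad h) u x + M / 2 * (n (x - u))\<^sup>2"
    and L: "L > 0" and M: "M > 0"
begin

lemma \<nu>_pos: "\<nu> > 0"
  using V by (simp add: prox_function_def)

text \<open>\<open>P\<close> stands for \<open>\<beta> * p t + q t\<close>. The new argument of
  \<open>h\<close> differs from the linearization point \<open>w\<close> by
  \<open>(l * a) *\<^sub>R (u' - u)\<close>, so the smoothness error carries
  \<open>(l * a)\<^sup>2\<close>. One factor \<open>l * a\<close> is turned by \<open>MP\<close>
  into \<open>P\<close>, and the result is cancelled by the term \<open>P * V u u'\<close> of the
  proximal inequality.\<close>

lemma prox_ag_step:
  fixes xl z :: 'a
  assumes xb: "xb \<in> X" and x: "x \<in> X" and ut: "ut \<in> X" and u: "u \<in> X"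
    and l: "0 \<le> l" "l \<le> 1" and a: "0 \<le> a" "a \<le> 1" and \<beta>: "\<beta> > 0" and P: "0 \<le> P"
    and MP: "M * l * a \<le> \<nu> * P"
  defines "g \<equiv> lin f df xl"
  defines "w \<equiv> (1 - l) *\<^sub>R xb + (l * (1 - a)) *\<^sub>R ut + (l * a) *\<^sub>R u"
  defines "u' \<equiv> arg_min_on (\<lambda>z. g z + lin h (grad h) w z + \<beta> * V x z + P * V u z) X"
  defines "ut' \<equiv> (1 - a) *\<^sub>R ut + a *\<^sub>R u'"
  defines "E \<equiv> \<lambda>z y. h ((1 - l) *\<^sub>R xb + l *\<^sub>R y) - (1 - l) * h xb - l * h z + l * (g y - g z)"
  shows "u' \<in> X" and "ut' \<in> X"
    and "z \<in> X \<Longrightarrow> E z ut' \<le> (1 - a) * E z ut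
      + l * a * (\<beta> * V x z - \<beta> * V x u' + P * V u z - (\<beta> + P) * V u' z)"
proof -
  define m where "m = lin h (grad h) w"
  define l0 where "l0 z = g z + m z" for z
  have l0: "l0 z = (f xl - df xl \<bullet> xl + h w - grad h w \<bullet> w) + (df xl + grad h w) \<bullet> z" for z
    by (simp add: l0_def m_def g_def lin_def inner_diff_right inner_add_left)
  have u'_def': "u' = arg_min_on (\<lambda>z. l0 z + \<beta> * V x z + P * V u z) X"
    by (simp add: u'_def l0_def m_def)
  note step = prox_step[OF closed n V x u \<beta> P l0, folded u'_def']
  show u': "u' \<in> X" by (fact step(1))
  then show ut': "ut' \<in> X" using cvx ut a by (auto simp: ut'_def intro!: convexD_alt)
  assume z: "z \<in> X"
  define ub where "ub = (1 - l) *\<^sub>R xb + l *\<^sub>R ut"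
  define ub' where "ub' = (1 - l) *\<^sub>R xb + l *\<^sub>R ut'"
  have ub: "ub \<in> X" using cvx xb ut l by (auto simp: ub_def intro!: convexD_alt)
  have ub': "ub' \<in> X" using cvx xb ut' l by (auto simp: ub'_def intro!: convexD_alt)
  have "w = (1 - l) *\<^sub>R xb + l *\<^sub>R ((1 - a) *\<^sub>R ut + a *\<^sub>R u)"
    by (simp add: w_def algebra_simps)
  also have "\<dots> \<in> X" using cvx xb ut u l a by (auto intro!: convexD_alt)
  finally have w: "w \<in> X" .
  have diff: "ub' - w = (l * a) *\<^sub>R (u' - u)"
    by (simp add: ub'_def w_def ut'_def algebra_simps)
  \<comment> \<open>The linearization is affine. On the part \<open>ub\<close> it is bounded by
    \<open>h\<close>, which gives the contraction factor \<open>1 - a\<close>; on the part with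
    \<open>u'\<close> it is bounded by the proximal inequality.\<close>
  have "ub' = (1 - a) *\<^sub>R ub + a *\<^sub>R ((1 - l) *\<^sub>R xb + l *\<^sub>R u')"
    by (simp add: ub'_def ub_def ut'_def algebra_simps)
  then have m_ub': "m ub' = (1 - a) * m ub + a * ((1 - l) * m xb + l * m u')"
    by (simp only: m_def lin_affine_comb)
  have "h ub' \<le> m ub' + M / 2 * (n (ub' - w))\<^sup>2"
    using h_bounds(2)[OF ub' w] by (simp add: m_def)
  also have "n (ub' - w) = l * a * n (u' - u)"
    using l a by (simp add: diff is_norm_scale[OF n])
  finally have h1: "h ub' \<le> m ub' + M / 2 * (l * a * n (u' - u))\<^sup>2" .
  have "M / 2 * (l * a * n (u' - u))\<^sup>2 = l * a / 2 * (M * l * a) * (n (u' - u))\<^sup>2"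
    by (simp add: power2_eq_square)
  also have "\<dots> \<le> l * a / 2 * (\<nu> * P) * (n (u' - u))\<^sup>2"
    using MP l a by (intro mult_right_mono mult_left_mono) auto
  also have "\<dots> = l * a * (P * (\<nu> / 2 * (n (u - u'))\<^sup>2))"
    by (simp add: is_norm_minus_commute[OF n, of u u'])
  also have "\<dots> \<le> l * a * (P * V u u')"
    using prox_function_lower_bound[OF V n u u'] P l a by (intro mult_left_mono) auto
  finally have h2: "M / 2 * (l * a * n (u' - u))\<^sup>2 \<le> l * a * (P * V u u')" .
  have h3: "(1 - a) * m ub \<le> (1 - a) * h ub" "a * ((1 - l) * m xb) \<le> a * ((1 - l) * h xb)"
    using h_bounds(1)[OF ub w] h_bounds(1)[OF xb w] a l
    by (auto simp: m_def intro!: mult_left_mono)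
  have "g u' + m u' + \<beta> * V x u' + P * V u u' + (\<beta> + P) * V u' z
      \<le> g z + m z + \<beta> * V x z + P * V u z"
    using step(2)[OF z] by (simp add: l0_def)
  also have "m z \<le> h z" using h_bounds(1)[OF z w] by (simp add: m_def)
  finally have "l * a * (g u' + m u' + \<beta> * V x u' + P * V u u' + (\<beta> + P) * V u' z)
      \<le> l * a * (g z + h z + \<beta> * V x z + P * V u z)"
    using l a by (intro mult_left_mono) auto
  moreover have "l * g ut' = (1 - a) * (l * g ut) + a * (l * g u')"
    by (simp only: g_def ut'_def lin_affine_comb) (simp add: algebra_simps)
  ultimately have "h ub' - (1 - l) * h xb - l * h z + l * (g ut' - g z) \<le>
      (1 - a) * (h ub - (1 - l) * h xb - l * h z + l * (g ut - g z))
      + l * a * (\<beta> * V x z - \<beta> * V x u' + P * V u z - (\<beta> + P) * V u' z)"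
    using h1 h2 h3 unfolding m_ub' right_diff_distrib[of l] by (simp add: algebra_simps)
  then show "E z ut' \<le> (1 - a) * E z ut
      + l * a * (\<beta> * V x z - \<beta> * V x u' + P * V u z - (\<beta> + P) * V u' z)"
    by (simp add: E_def ub_def ub'_def)
qed

text \<open>The term with \<open>1 - \<Theta> t\<close> is the part of \<open>V x (u t)\<close> that is kept back to absorb the
  quadratic error of the linearization of \<open>f\<close> in the outer iteration.\<close>

lemma prox_ag_bound:
  fixes xl z :: 'a
  assumes xb: "xb \<in> X" and x: "x \<in> X"
    and l: "0 \<le> l" "l \<le> 1" and \<beta>: "\<beta> > 0"
    and \<alpha>: "\<And>t. 1 \<le> t \<Longrightarrow> 0 < \<alpha> t" "\<And>t. 1 \<le> t \<Longrightarrow> \<alpha> t \<le> 1" "\<And>t. 2 \<le> t \<Longrightarrow> \<alpha> t < 1"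
    and pq: "\<And>t. 1 \<le> t \<Longrightarrow> 0 \<le> \<beta> * p t + q t"
      "\<And>t. 1 \<le> t \<Longrightarrow> M * l * \<alpha> t \<le> \<nu> * (\<beta> * p t + q t)"
    and \<eta>: "\<And>t. \<eta> t = \<alpha> t * (\<beta> + (\<beta> * p t + q t))"
      "\<And>t. 1 \<le> t \<Longrightarrow> \<alpha> (Suc t) * (\<beta> * p (Suc t) + q (Suc t)) = (1 - \<alpha> (Suc t)) * \<eta> t"
  defines "g \<equiv> lin f df xl"
  defines "E \<equiv> \<lambda>z y. h ((1 - l) *\<^sub>R xb + l *\<^sub>R y) - (1 - l) * h xb - l * h z + l * (g y - g z)"
  defines "\<Theta> \<equiv> \<lambda>t. \<Prod>i=1..t. 1 - \<alpha> i"
  defines "u \<equiv> \<lambda>t. fst (prox_ag X V h \<alpha> p q g xb x l \<beta> t)"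
  defines "ut \<equiv> \<lambda>t. fst (snd (prox_ag X V h \<alpha> p q g xb x l \<beta> t))"
  assumes t: "1 \<le> t"
  shows "u t \<in> X" and "ut t \<in> X" and "0 \<le> \<Theta> t" and "\<Theta> t < 1"
    and "z \<in> X \<Longrightarrow> E z (ut t) + l * \<eta> t * V (u t) z
        + l * \<beta> * \<nu> / 2 * ((n (ut t - \<Theta> t *\<^sub>R xb - (1 - \<Theta> t) *\<^sub>R x))\<^sup>2 / (1 - \<Theta> t))
      \<le> \<Theta> t * E z xb + l * \<eta> t * V x z"
proof -
  have u0: "u 0 = x" "ut 0 = xb" by (simp_all add: u_def ut_def)
  have uSuc: "u (Suc t) = arg_min_on (\<lambda>z. g z
      + lin h (grad h) ((1 - l) *\<^sub>R xb + (l * (1 - \<alpha> (Suc t))) *\<^sub>R ut t + (l * \<alpha> (Suc t)) *\<^sub>R u t) z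
      + \<beta> * V x z + (\<beta> * p (Suc t) + q (Suc t)) * V (u t) z) X" for t
    by (simp add: u_def ut_def Let_def case_prod_beta)
  have utSuc: "ut (Suc t) = (1 - \<alpha> (Suc t)) *\<^sub>R ut t + \<alpha> (Suc t) *\<^sub>R u (Suc t)" for t
    by (simp add: u_def ut_def Let_def case_prod_beta)
  have inner: "u (Suc t) \<in> X" "ut (Suc t) \<in> X"
      "z \<in> X \<Longrightarrow> E z (ut (Suc t)) \<le> (1 - \<alpha> (Suc t)) * E z (ut t)
        + l * \<alpha> (Suc t) * (\<beta> * V x z - \<beta> * V x (u (Suc t)) + (\<beta> * p (Suc t) + q (Suc t)) * V (u t) z
        - (\<beta> + (\<beta> * p (Suc t) + q (Suc t))) * V (u (Suc t)) z)"
    if ut: "ut t \<in> X" and u: "u t \<in> X" for t z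
  proof -
    have a: "0 \<le> \<alpha> (Suc t)" "\<alpha> (Suc t) \<le> 1" using \<alpha>(1,2)[of "Suc t"] by auto
    note s = prox_ag_step[where xl = xl, OF xb x ut u l a \<beta> pq(1)[of "Suc t"] pq(2)[of "Suc t"],
      folded g_def, folded uSuc, folded utSuc]
    show "u (Suc t) \<in> X" "ut (Suc t) \<in> X" using s(1,2) by simp_all
    assume "z \<in> X"
    from s(3)[OF _ _ this] show "E z (ut (Suc t)) \<le> (1 - \<alpha> (Suc t)) * E z (ut t)
        + l * \<alpha> (Suc t) * (\<beta> * V x z - \<beta> * V x (u (Suc t)) + (\<beta> * p (Suc t) + q (Suc t)) * V (u t) z
        - (\<beta> + (\<beta> * p (Suc t) + q (Suc t))) * V (u (Suc t)) z)"
      by (simp add: E_def)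
  qed
  have mem: "u t \<in> X \<and> ut t \<in> X" for t
    by (induction t) (auto simp: u0 x xb inner)
  then show "u t \<in> X" "ut t \<in> X" by auto
  have \<Theta>: "0 \<le> \<Theta> t \<and> \<Theta> t < 1" if "1 \<le> t" for t
    using that
  proof (induction t rule: dec_induct)
    case base
    then show ?case using \<alpha>(1,2)[of 1] by (simp add: \<Theta>_def)
  next
    case (step t)
    have "\<Theta> (Suc t) = \<Theta> t * (1 - \<alpha> (Suc t))" by (simp add: \<Theta>_def)
    moreover have "\<dots> \<le> \<Theta> t * 1"
      using step \<alpha>(1)[of "Suc t"] by (intro mult_left_mono) auto
    ultimately show ?case using step \<alpha>(2)[of "Suc t"] by auto
  qed
  then show "0 \<le> \<Theta> t" "\<Theta> t < 1" using t by auto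
  assume z: "z \<in> X"
  \<comment> \<open>By \<open>dSuc\<close> this is the combination of the steps
    \<open>u i - x\<close> with weights \<alpha> i (1 - \<alpha> (i + 1)) ... (1 - \<alpha> t).
    These weights add up to \<open>1 - \<Theta> t\<close>, hence the denominator below.\<close>
  define d where "d t = ut t - \<Theta> t *\<^sub>R xb - (1 - \<Theta> t) *\<^sub>R x" for t
  have d1: "d 1 = \<alpha> 1 *\<^sub>R (u 1 - x)"
    using utSuc[of 0] by (simp add: d_def \<Theta>_def u0 algebra_simps)
  have dSuc: "d (Suc t) = (1 - \<alpha> (Suc t)) *\<^sub>R d t + \<alpha> (Suc t) *\<^sub>R (u (Suc t) - x)" for t
    by (simp add: d_def \<Theta>_def utSuc algebra_simps)
  have Vlow: "l * \<beta> * (\<alpha> (Suc t) * (\<nu> / 2 * (n (u (Suc t) - x))\<^sup>2)) \<le> l * \<beta> * (\<alpha> (Suc t) * V x (u (Suc t)))" for t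
  proof -
    have "\<nu> / 2 * (n (u (Suc t) - x))\<^sup>2 \<le> V x (u (Suc t))"
      using prox_function_lower_bound[OF V n x, of "u (Suc t)"] mem[of "Suc t"]
      by (simp add: is_norm_minus_commute[OF n, of x])
    then show ?thesis using l \<beta> \<alpha>(1)[of "Suc t"] by (intro mult_left_mono) auto
  qed
  have "E z (ut t) + l * \<eta> t * V (u t) z + l * \<beta> * \<nu> / 2 * ((n (d t))\<^sup>2 / (1 - \<Theta> t))
      \<le> \<Theta> t * E z xb + l * \<eta> t * V x z"
    using t
  proof (induction t rule: dec_induct)
    case base
    have a: "\<alpha> 1 > 0" using \<alpha>(1) by simp
    have "(n (d 1))\<^sup>2 / (1 - \<Theta> 1) = \<alpha> 1 * (n (u 1 - x))\<^sup>2"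
      using a unfolding d1 by (simp add: is_norm_scale[OF n] \<Theta>_def power2_eq_square)
    then show ?case
      using Vlow[of 0] inner(3)[of 0 z] z mem[of 0]
      by (simp add: u0 \<eta> \<Theta>_def algebra_simps)
  next
    case (step t)
    define a where "a = \<alpha> (Suc t)"
    \<comment> \<open>Only \<open>\<alpha> 1\<close> may be 1, and it belongs to the base case; here
      \<open>1 - a\<close> occurs in a denominator.\<close>
    have a: "0 < a" "a < 1" using \<alpha>(1,3)[of "Suc t"] step(1) by (auto simp: a_def)
    have \<Theta>t: "\<Theta> t < 1" using \<Theta> step(1) by auto
    have \<Theta>Suc: "\<Theta> (Suc t) = (1 - a) * \<Theta> t" by (simp add: \<Theta>_def a_def)
    \<comment> \<open>The denominator splits as the Engel form requires, so the kept-back square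
      contracts by \<open>1 - a\<close> like everything else.\<close>
    have eq: "1 - \<Theta> (Suc t) = (1 - a) * (1 - \<Theta> t) + a"
      by (simp add: \<Theta>Suc algebra_simps)
    have "n (d (Suc t)) \<le> (1 - a) * n (d t) + a * n (u (Suc t) - x)"
      using is_norm_triangle[OF n, of "(1 - a) *\<^sub>R d t" "a *\<^sub>R (u (Suc t) - x)"] a
      by (simp add: dSuc a_def is_norm_scale[OF n])
    then have "(n (d (Suc t)))\<^sup>2 \<le> ((1 - a) * n (d t) + a * n (u (Suc t) - x))\<^sup>2"
      by (intro power_mono is_norm_nonneg[OF n])
    then have "(n (d (Suc t)))\<^sup>2 / (1 - \<Theta> (Suc t)) \<le>
        ((1 - a) * n (d t) + a * n (u (Suc t) - x))\<^sup>2 / ((1 - a) * (1 - \<Theta> t) + a)"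
      unfolding eq using a \<Theta>t by (intro divide_right_mono) auto
    also have "\<dots> \<le> ((1 - a) * n (d t))\<^sup>2 / ((1 - a) * (1 - \<Theta> t)) + (a * n (u (Suc t) - x))\<^sup>2 / a"
      using a \<Theta>t by (intro square_sum_over_sum_le) auto
    also have "\<dots> = (1 - a) * ((n (d t))\<^sup>2 / (1 - \<Theta> t)) + a * (n (u (Suc t) - x))\<^sup>2"
      using a \<Theta>t by (simp add: power_mult_distrib power2_eq_square)
    finally have D0: "l * \<beta> * \<nu> / 2 * ((n (d (Suc t)))\<^sup>2 / (1 - \<Theta> (Suc t))) \<le>
        l * \<beta> * \<nu> / 2 * ((1 - a) * ((n (d t))\<^sup>2 / (1 - \<Theta> t)) + a * (n (u (Suc t) - x))\<^sup>2)"
      using l \<beta> \<nu>_pos by (intro mult_left_mono) auto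
    have D1: "l * \<beta> * \<nu> / 2 * ((1 - a) * Q + a * r) =
        (1 - a) * (l * \<beta> * \<nu> / 2 * Q) + l * \<beta> * (a * (\<nu> / 2 * r))" for Q r :: real
      by (simp add: field_simps)
    have D: "l * \<beta> * \<nu> / 2 * ((n (d (Suc t)))\<^sup>2 / (1 - \<Theta> (Suc t))) \<le>
        (1 - a) * (l * \<beta> * \<nu> / 2 * ((n (d t))\<^sup>2 / (1 - \<Theta> t))) + l * \<beta> * (a * V x (u (Suc t)))"
      using D0 Vlow[of t] unfolding D1 a_def[symmetric] by linarith
    have IH: "(1 - a) * (E z (ut t) + l * \<eta> t * V (u t) z + l * \<beta> * \<nu> / 2 * ((n (d t))\<^sup>2 / (1 - \<Theta> t)))
        \<le> (1 - a) * (\<Theta> t * E z xb + l * \<eta> t * V x z)"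
      using a step.IH by (intro mult_left_mono) auto
    define P where "P = \<beta> * p (Suc t) + q (Suc t)"
    have S: "E z (ut (Suc t)) \<le> (1 - a) * E z (ut t)
        + l * (a * \<beta>) * V x z - l * \<beta> * (a * V x (u (Suc t))) + l * (a * P) * V (u t) z
        - l * \<eta> (Suc t) * V (u (Suc t)) z"
      using inner(3)[of t z] z mem[of t]
      by (simp add: \<eta>(1) a_def P_def algebra_simps)
    \<comment> \<open>Because of this coupling the new term in \<open>V (u t) z\<close> equals the
      old one contracted by \<open>1 - a\<close>, so the two cancel and the Bregman terms
      telescope.\<close>
    have aP: "a * P = (1 - a) * \<eta> t" using \<eta>(2)[of t] step(1) by (simp add: a_def P_def)
    have \<eta>Suc: "\<eta> (Suc t) = a * \<beta> + (1 - a) * \<eta> t"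
      using aP by (simp add: \<eta>(1)[of "Suc t"] a_def P_def algebra_simps)
    have V1: "l * \<eta> (Suc t) * V x z = l * (a * \<beta>) * V x z + (1 - a) * (l * \<eta> t * V x z)"
      by (simp add: \<eta>Suc algebra_simps)
    have V2: "l * (a * P) * V (u t) z = (1 - a) * (l * \<eta> t * V (u t) z)"
      by (simp add: aP)
    have "\<Theta> (Suc t) * E z xb = (1 - a) * (\<Theta> t * E z xb)" by (simp add: \<Theta>Suc)
    with D IH S V1 V2 show ?case by (simp only: distrib_left)
  qed
  then show "E z (ut t) + l * \<eta> t * V (u t) z
        + l * \<beta> * \<nu> / 2 * ((n (ut t - \<Theta> t *\<^sub>R xb - (1 - \<Theta> t) *\<^sub>R x))\<^sup>2 / (1 - \<Theta> t))
      \<le> \<Theta> t * E z xb + l * \<eta> t * V x z"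
    by (simp add: d_def)
qed

text \<open>The relation between \<open>\<gamma>\<close> and \<open>l\<close> gives
  \<open>xb' - xl = l *\<^sub>R d\<close> with \<open>d\<close> the averaged step. The error of
  \<open>f\<close> is then \<open>L / 2 * l\<^sup>2\<close> times the square of \<open>n d\<close>,
  and \<open>L\<gamma>\<close> says that the square kept back in \<open>prox_ag_bound\<close> covers
  it.\<close>

lemma outer_step:
  assumes xb: "xb \<in> X" and x: "x \<in> X"
    and l: "0 \<le> l" "l \<le> 1" and \<beta>: "\<beta> > 0"
    and \<alpha>: "\<And>t. 1 \<le> t \<Longrightarrow> 0 < \<alpha> t" "\<And>t. 1 \<le> t \<Longrightarrow> \<alpha> t \<le> 1" "\<And>t. 2 \<le> t \<Longrightarrow> \<alpha> t < 1"
    and pq: "\<And>t. 1 \<le> t \<Longrightarrow> 0 \<le> \<beta> * p t + q t"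
      "\<And>t. 1 \<le> t \<Longrightarrow> M * l * \<alpha> t \<le> \<nu> * (\<beta> * p t + q t)"
    and \<eta>: "\<And>t. \<eta> t = \<alpha> t * (\<beta> + (\<beta> * p t + q t))"
      "\<And>t. 1 \<le> t \<Longrightarrow> \<alpha> (Suc t) * (\<beta> * p (Suc t) + q (Suc t)) = (1 - \<alpha> (Suc t)) * \<eta> t"
    and T: "1 \<le> T" and \<gamma>: "\<gamma> = l * (1 - (\<Prod>i=1..T. 1 - \<alpha> i))" and L\<gamma>: "L * \<gamma> \<le> \<beta> * \<nu>"
    and run: "(x', xt, c) =
      prox_ag X V h \<alpha> p q (lin f df ((1 - \<gamma>) *\<^sub>R xb + \<gamma> *\<^sub>R x)) xb x l \<beta> T"
  defines "xb' \<equiv> (1 - l) *\<^sub>R xb + l *\<^sub>R xt"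
  shows "x' \<in> X" and "xb' \<in> X"
    and "z \<in> X \<Longrightarrow> f xb' + h xb' - (f z + h z) \<le>
      (1 - \<gamma>) * (f xb + h xb - (f z + h z)) + l * \<eta> T * (V x z - V x' z)"
proof -
  define xl where "xl = (1 - \<gamma>) *\<^sub>R xb + \<gamma> *\<^sub>R x"
  define g where "g = lin f df xl"
  define \<Theta> where "\<Theta> = (\<Prod>i=1..T. 1 - \<alpha> i)"
  define d where "d = xt - \<Theta> *\<^sub>R xb - (1 - \<Theta>) *\<^sub>R x"
  have eqs: "fst (prox_ag X V h \<alpha> p q (lin f df xl) xb x l \<beta> T) = x'"
    "fst (snd (prox_ag X V h \<alpha> p q (lin f df xl) xb x l \<beta> T)) = xt"
    using run by (simp_all add: xl_def flip: run)
  note prox = prox_ag_bound[where \<alpha> = \<alpha> and p = p and q = q and \<eta> = \<eta>, OF xb x l \<beta> \<alpha> pq \<eta> T]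
  note bound = prox(1,2,5)[where xl = xl, unfolded eqs, folded \<Theta>_def g_def]
  show x': "x' \<in> X" using bound(1) by simp
  have xt: "xt \<in> X" using bound(2) by simp
  then show xb': "xb' \<in> X" using cvx xb l by (auto simp: xb'_def intro!: convexD_alt)
  have \<Theta>: "0 \<le> \<Theta>" "\<Theta> < 1" using prox(3,4) by (simp_all add: \<Theta>_def)
  have \<gamma>': "\<gamma> = l * (1 - \<Theta>)" by (simp add: \<gamma> \<Theta>_def)
  have "\<gamma> \<le> 1 * 1" unfolding \<gamma>' using l \<Theta> by (intro mult_mono) auto
  then have \<gamma>01: "0 \<le> \<gamma>" "\<gamma> \<le> 1" using l \<Theta> by (auto simp: \<gamma>')
  have xl: "xl \<in> X" using cvx xb x \<gamma>01 by (auto simp: xl_def intro!: convexD_alt)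
  assume z: "z \<in> X"
  have "h xb' - (1 - l) * h xb - l * h z + l * (g xt - g z) + l * \<eta> T * V x' z
        + l * \<beta> * \<nu> / 2 * ((n d)\<^sup>2 / (1 - \<Theta>))
      \<le> \<Theta> * (h ((1 - l) *\<^sub>R xb + l *\<^sub>R xb) - (1 - l) * h xb - l * h z + l * (g xb - g z))
        + l * \<eta> T * V x z"
    unfolding xb'_def d_def by (rule bound(3)) (use z in auto)
  \<comment> \<open>At the starting point \<open>xb\<close> the argument of \<open>h\<close>
    collapses, so \<open>h xb\<close> receives the total weight
    \<open>1 - l + \<Theta> * l = 1 - \<gamma>\<close>.\<close>
  also have "(1 - l) *\<^sub>R xb + l *\<^sub>R xb = xb" by (simp add: algebra_simps)
  finally have B: "h xb' - (1 - l) * h xb - l * h z + l * (g xt - g z) + l * \<eta> T * V x' z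
        + l * \<beta> * \<nu> / 2 * ((n d)\<^sup>2 / (1 - \<Theta>))
      \<le> \<Theta> * (h xb - (1 - l) * h xb - l * h z + l * (g xb - g z)) + l * \<eta> T * V x z" .
  have "xb' - xl = l *\<^sub>R d"
    by (simp add: xb'_def xl_def d_def \<gamma>' algebra_simps)
  then have "L / 2 * (n (xb' - xl))\<^sup>2 = l / 2 * (L * \<gamma>) * ((n d)\<^sup>2 / (1 - \<Theta>))"
    using l \<Theta> by (simp add: is_norm_scale[OF n] \<gamma>' power_mult_distrib)
      (simp add: power2_eq_square field_simps)
  also have "\<dots> \<le> l / 2 * (\<beta> * \<nu>) * ((n d)\<^sup>2 / (1 - \<Theta>))"
    using l \<Theta> L\<gamma> by (intro mult_right_mono mult_left_mono) auto
  finally have "L / 2 * (n (xb' - xl))\<^sup>2 \<le> l * \<beta> * \<nu> / 2 * ((n d)\<^sup>2 / (1 - \<Theta>))"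
    by (simp add: mult.assoc)
  moreover have "f xb' \<le> g xb' + L / 2 * (n (xb' - xl))\<^sup>2"
    using f_bounds(2)[OF xb' xl] by (simp add: g_def)
  moreover have "g xb' = (1 - l) * g xb + l * g xt"
    by (simp add: g_def xb'_def lin_affine_comb)
  ultimately have F: "f xb' \<le> (1 - l) * g xb + l * g xt + l * \<beta> * \<nu> / 2 * ((n d)\<^sup>2 / (1 - \<Theta>))"
    by linarith
  have G: "(1 - \<gamma>) * g xb \<le> (1 - \<gamma>) * f xb" "\<gamma> * g z \<le> \<gamma> * f z"
    using \<gamma>01 f_bounds(1)[OF xb xl] f_bounds(1)[OF z xl]
    by (auto simp: g_def intro!: mult_left_mono)
  have "f xb' + h xb' \<le> (1 - \<gamma>) * (g xb + h xb) + \<gamma> * (g z + h z) + l * \<eta> T * (V x z - V x' z)"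
    using B F by (simp add: \<gamma>' algebra_simps)
  then show "f xb' + h xb' - (f z + h z) \<le>
      (1 - \<gamma>) * (f xb + h xb - (f z + h z)) + l * \<eta> T * (V x z - V x' z)"
    using G by (simp add: algebra_simps)
qed

end

section \<open>The prescribed parameters and the telescoped bound\<close>

lemma ags_T_first:
  assumes "L > 0" "M > 0"
  shows "1 \<le> ags_T L M 1" and "8 * M / (7 * L) \<le> (real (ags_T L M 1))\<^sup>2"
    and "real (ags_T L M 1) \<le> sqrt (8 * M / (7 * L)) + 1"
proof -
  let ?s = "sqrt (8 * M / (7 * L))"
  have T: "ags_T L M 1 = nat \<lceil>?s\<rceil>" by (simp add: ags_T_def)
  have s: "?s > 0" using assms by simp
  then have "0 < \<lceil>?s\<rceil>" by simp
  then show "1 \<le> ags_T L M 1" unfolding T by linarith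
  have le: "?s \<le> real (ags_T L M 1)" unfolding T by (rule real_nat_ceiling_ge)
  then have "?s\<^sup>2 \<le> (real (ags_T L M 1))\<^sup>2" using s by (intro power_mono) auto
  then show "8 * M / (7 * L) \<le> (real (ags_T L M 1))\<^sup>2" using assms by simp
  show "real (ags_T L M 1) \<le> ?s + 1" unfolding T using s by linarith
qed

text \<open>\<open>p / (p + 1)\<close> is \<open>1 - \<alpha>\<close>. The \<open>ln 3\<close> in
  the numerator makes the inner iterations contract by at least 1/3 in total; the upper bound on
  their number comes from \<open>ln y \<le> y - 1\<close>.\<close>

lemma ags_T_later:
  assumes "L > 0" "M > 0" and k: "k \<noteq> 1"
  defines "p \<equiv> sqrt (M / L)"
  shows "1 \<le> ags_T L M k" and "(p / (p + 1)) ^ ags_T L M k \<le> 1 / 3"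
    and "real (ags_T L M k) \<le> (p + 1) * ln 3 + 1"
proof -
  have p: "p > 0" using assms by (simp add: p_def)
  define r where "r = ln 3 / (- ln (p / (p + 1)))"
  have "1 - ags_alpha L M k 1 = p / (p + 1)"
    using p k by (simp add: ags_alpha_def p_def[symmetric] field_simps)
  then have T: "ags_T L M k = nat \<lceil>r\<rceil>"
    using k by (simp add: ags_T_def r_def)
  have neg: "ln (p / (p + 1)) < 0" using p by (subst ln_less_zero_iff) auto
  then have r: "r > 0" unfolding r_def by (intro divide_pos_pos) auto
  then have "0 < \<lceil>r\<rceil>" by simp
  then show "1 \<le> ags_T L M k" unfolding T by linarith
  have "r \<le> real (ags_T L M k)" unfolding T by (rule real_nat_ceiling_ge)
  then have "ln 3 \<le> real (ags_T L M k) * (- ln (p / (p + 1)))"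
    using neg by (simp add: r_def field_simps)
  then have "ln ((p / (p + 1)) ^ ags_T L M k) \<le> ln (1 / 3)"
    using p by (simp add: ln_realpow ln_div algebra_simps)
  then show "(p / (p + 1)) ^ ags_T L M k \<le> 1 / 3"
    using p by (subst (asm) ln_le_cancel_iff) auto
  have "ln (p / (p + 1)) \<le> p / (p + 1) - 1" using p by (intro ln_le_minus_one) simp
  also have "\<dots> = - (1 / (p + 1))" using p by (simp add: field_simps)
  finally have "1 / (p + 1) \<le> - ln (p / (p + 1))" by simp
  then have "r \<le> ln 3 / (1 / (p + 1))"
    unfolding r_def using p by (intro divide_left_mono mult_pos_pos) (auto simp: neg)
  then have "r \<le> (p + 1) * ln 3" by (simp add: mult.commute)
  then show "real (ags_T L M k) \<le> (p + 1) * ln 3 + 1" unfolding T using r by linarith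
qed

context ags_setting
begin

text \<open>Here \<open>\<alpha> 1 = 1\<close>, so the product \<open>\<Theta>\<close> vanishes, and
  \<open>\<gamma> = \<lambda> = 1\<close>: the previous \<open>xb\<close> drops out of the
  bound.\<close>

lemma ags_first_step:
  assumes xb: "xb \<in> X" and x: "x \<in> X"
    and run: "(x', xt, c) = prox_ag X V h (ags_alpha L M 1) (ags_p L M 1) (ags_q L M \<nu> 1)
      (lin f df ((1 - ags_gamma 1) *\<^sub>R xb + ags_gamma 1 *\<^sub>R x)) xb x
      (ags_lambda L M 1) (ags_beta L M \<nu> 1) (ags_T L M 1)"
  defines "xb' \<equiv> (1 - ags_lambda L M 1) *\<^sub>R xb + ags_lambda L M 1 *\<^sub>R xt"
  shows "x' \<in> X" and "xb' \<in> X"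
    and "z \<in> X \<Longrightarrow> f xb' + h xb' - (f z + h z) \<le>
      (1 - ags_gamma 1) * (f xb + h xb - (f z + h z)) + 9 * L / (2 * \<nu>) * (V x z - V x' z)"
proof -
  define T where "T = ags_T L M 1"
  have T: "1 \<le> T" "8 * M / (7 * L) \<le> (real T)\<^sup>2"
    using ags_T_first[OF L M] by (auto simp: T_def)
  \<comment> \<open>\<open>C / t\<close> is \<open>\<nu> * q t\<close>. The choice of
    \<open>T_1\<close> is what yields \<open>2 * M \<le> C\<close>, and then \<open>q t\<close>
    alone satisfies the smoothness condition, as \<open>2 * M / (t + 1) \<le> C / t\<close>.\<close>
  define C where "C = 7 * L * real T * (real T + 1) / 4"
  have "2 * M \<le> 7 * L * (real T)\<^sup>2 / 4" using T(2) L by (simp add: field_simps)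
  also have "\<dots> \<le> C" using L T by (simp add: C_def power2_eq_square)
  finally have C: "2 * M \<le> C" .
  have \<alpha>: "ags_alpha L M 1 t = 2 / (real t + 1)" for t by (simp add: ags_alpha_def)
  have P: "ags_beta L M \<nu> 1 * ags_p L M 1 t + ags_q L M \<nu> 1 t
      = (L * (real t - 1) / 2 + C / real t) / \<nu>" for t
    using \<nu>_pos by (simp add: ags_beta_def ags_p_def ags_q_def C_def T_def add_divide_distrib mult_ac)
  have l: "ags_lambda L M 1 = 1" by (simp add: ags_lambda_def)
  have \<beta>: "ags_beta L M \<nu> 1 = L / \<nu>" by (simp add: ags_beta_def)
  have \<gamma>: "ags_gamma 1 = 1" by (simp add: ags_gamma_def)
  define \<eta> where "\<eta> t = ags_alpha L M 1 t * (ags_beta L M \<nu> 1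
    + (ags_beta L M \<nu> 1 * ags_p L M 1 t + ags_q L M \<nu> 1 t))" for t
  have c6: "0 \<le> ags_beta L M \<nu> 1 * ags_p L M 1 t + ags_q L M \<nu> 1 t" if "1 \<le> t" for t
    unfolding P using that L M C \<nu>_pos by simp
  have c7: "M * ags_lambda L M 1 * ags_alpha L M 1 t
      \<le> \<nu> * (ags_beta L M \<nu> 1 * ags_p L M 1 t + ags_q L M \<nu> 1 t)" if "1 \<le> t" for t
  proof -
    have "M * ags_lambda L M 1 * ags_alpha L M 1 t = 2 * M / (real t + 1)"
      unfolding l \<alpha> by simp
    also have "\<dots> \<le> C / real t"
      using that M C by (intro frac_le) auto
    also have "\<dots> \<le> \<nu> * (ags_beta L M \<nu> 1 * ags_p L M 1 t + ags_q L M \<nu> 1 t)"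
      unfolding P using that L \<nu>_pos by simp
    finally show ?thesis .
  qed
  have c9: "ags_alpha L M 1 (Suc t) * (ags_beta L M \<nu> 1 * ags_p L M 1 (Suc t) + ags_q L M \<nu> 1 (Suc t))
      = (1 - ags_alpha L M 1 (Suc t)) * \<eta> t" if "1 \<le> t" for t
  proof -
    have "real t > 0" using that by simp
    then show ?thesis
      unfolding \<eta>_def P unfolding \<alpha> \<beta> using \<nu>_pos by (simp add: divide_simps) (simp add: algebra_simps)
  qed
  have c10: "ags_gamma 1 = ags_lambda L M 1 * (1 - (\<Prod>i=1..T. 1 - ags_alpha L M 1 i))"
  proof -
    have "(\<Prod>i=1..T. 1 - ags_alpha L M 1 i) = 0"
      using T(1) unfolding \<alpha> by (intro prod_zero) (auto intro!: bexI[of _ 1])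
    then show ?thesis unfolding \<gamma> l by (simp only: diff_zero mult_1)
  qed
  \<comment> \<open>The 9/2 arises as \<open>2 / (T + 1)\<close> times
    \<open>(T + 1) * (1 / 2 + 7 / 4)\<close>: the part 1/2 comes from \<open>\<beta>\<close> and
    \<open>p\<close>, the part 7/4 from \<open>q\<close>.\<close>
  have "\<eta> T = 9 * L / (2 * \<nu>)"
    unfolding \<eta>_def P unfolding \<alpha> \<beta> C_def using \<nu>_pos T(1) by (simp add: divide_simps) (simp add: algebra_simps)
  then have \<eta>T: "ags_lambda L M 1 * \<eta> T = 9 * L / (2 * \<nu>)" unfolding l by simp
  have c4: "0 < ags_alpha L M 1 t" for t unfolding \<alpha> by simp
  have c5: "ags_alpha L M 1 t \<le> 1" if "1 \<le> t" for t using that unfolding \<alpha> by simp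
  have c5': "ags_alpha L M 1 t < 1" if "2 \<le> t" for t using that unfolding \<alpha> by simp
  have c1: "0 \<le> ags_lambda L M 1" "ags_lambda L M 1 \<le> 1" "0 < ags_beta L M \<nu> 1"
    "L * ags_gamma 1 \<le> ags_beta L M \<nu> 1 * \<nu>"
    unfolding l \<beta> \<gamma> using L \<nu>_pos by simp_all
  note step = outer_step[OF xb x c1(1-3) c4 c5 c5' c6 c7 \<eta>_def c9 T(1) c10 c1(4) run[folded T_def]]
  show "x' \<in> X" "xb' \<in> X" using step(1,2) by (simp_all add: xb'_def)
  assume "z \<in> X"
  from step(3)[OF _ _ _ _ _ this] show "f xb' + h xb' - (f z + h z) \<le>
      (1 - ags_gamma 1) * (f xb + h xb - (f z + h z)) + 9 * L / (2 * \<nu>) * (V x z - V x' z)"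
    unfolding xb'_def \<eta>T by simp
qed

text \<open>From \<open>\<theta> \<le> 1 / 3\<close> follow
  \<open>l \<le> 3 / 2 * \<gamma> \<le> 1\<close> and then
  \<open>\<beta> * \<nu> \<ge> 3 * L / k\<close>. This covers both smoothness conditions, since
  \<open>l \<le> 3 / k\<close> serves for \<open>h\<close> and \<open>\<gamma> \<le> 3 / k\<close>
  for \<open>f\<close>.\<close>

lemma ags_later_step:
  assumes k: "2 \<le> k" and xb: "xb \<in> X" and x: "x \<in> X"
    and run: "(x', xt, c) = prox_ag X V h (ags_alpha L M k) (ags_p L M k) (ags_q L M \<nu> k)
      (lin f df ((1 - ags_gamma k) *\<^sub>R xb + ags_gamma k *\<^sub>R x)) xb x
      (ags_lambda L M k) (ags_beta L M \<nu> k) (ags_T L M k)"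
  defines "xb' \<equiv> (1 - ags_lambda L M k) *\<^sub>R xb + ags_lambda L M k *\<^sub>R xt"
  shows "x' \<in> X" and "xb' \<in> X"
    and "z \<in> X \<Longrightarrow> f xb' + h xb' - (f z + h z) \<le>
      (1 - ags_gamma k) * (f xb + h xb - (f z + h z))
        + 9 * L / (\<nu> * (real k * (real k + 1))) * (V x z - V x' z)"
proof -
  define T where "T = ags_T L M k"
  define p where "p = sqrt (M / L)"
  define \<theta> where "\<theta> = (p / (p + 1)) ^ T"
  define l where "l = ags_lambda L M k"
  define \<gamma> where "\<gamma> = ags_gamma k"
  define \<beta> where "\<beta> = ags_beta L M \<nu> k"
  have p: "p > 0" using L M by (simp add: p_def)
  have Mp: "M = L * p\<^sup>2" using L M by (simp add: p_def)
  have k1: "k \<noteq> 1" using k by simp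
  have T: "1 \<le> T" "\<theta> \<le> 1 / 3"
    using ags_T_later[OF L M k1] by (auto simp: T_def \<theta>_def p_def)
  have \<theta>0: "0 \<le> \<theta>" using p by (simp add: \<theta>_def)
  have \<alpha>: "ags_alpha L M k t = 1 / (p + 1)" for t using k by (simp add: ags_alpha_def p_def)
  have \<alpha>': "1 - 1 / (p + 1) = p / (p + 1)" using p by (simp add: field_simps)
  have \<gamma>k: "\<gamma> = 2 / (real k + 1)" by (simp add: \<gamma>_def ags_gamma_def)
  have \<gamma>0: "0 < \<gamma>" "\<gamma> \<le> 2 / 3" using k by (auto simp: \<gamma>k field_simps)
  have lk: "l = \<gamma> / (1 - \<theta>)" using k by (simp add: l_def ags_lambda_def \<alpha> \<alpha>' T_def \<theta>_def \<gamma>_def)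
  have l32: "l \<le> 3 / 2 * \<gamma>"
  proof -
    have "\<gamma> / (1 - \<theta>) \<le> \<gamma> / (2 / 3)" using \<gamma>0 T by (intro divide_left_mono) auto
    then show ?thesis by (simp add: lk)
  qed
  have l: "0 < l" "l \<le> 1" using l32 \<gamma>0 T by (auto simp: lk)
  have \<beta>k: "\<beta> = 9 * L * \<gamma> / (2 * \<nu> * real k * l)"
    using k by (simp add: \<beta>_def ags_beta_def \<gamma>_def l_def)
  have \<beta>: "\<beta> > 0" using L \<nu>_pos \<gamma>0 l k by (simp add: \<beta>k)
  have "\<beta> * \<nu> = 9 * L * \<gamma> / (2 * real k * l)" using \<nu>_pos by (simp add: \<beta>k)
  also have "\<dots> \<ge> 9 * L * \<gamma> / (2 * real k * (3 / 2 * \<gamma>))"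
    using L \<gamma>0 k l l32 by (intro divide_left_mono mult_left_mono mult_pos_pos) auto
  also have "9 * L * \<gamma> / (2 * real k * (3 / 2 * \<gamma>)) = 3 * L / real k"
    using \<gamma>0 by simp
  finally have \<beta>\<nu>: "3 * L / real k \<le> \<beta> * \<nu>" .
  have P: "ags_beta L M \<nu> k * ags_p L M k t + ags_q L M \<nu> k t = \<beta> * p" for t
    using k by (simp add: \<beta>_def ags_p_def ags_q_def p_def)
  have c7: "M * l * (1 / (p + 1)) \<le> \<nu> * (\<beta> * p)"
  proof -
    have "M * l * (1 / (p + 1)) = L * p * l * (p / (p + 1))" by (simp add: Mp power2_eq_square)
    also have "\<dots> \<le> L * p * l * 1" using L p l by (intro mult_left_mono) auto
    also have "\<dots> = L * p * l" by simp
    also have "\<dots> \<le> L * p * (3 / real k)"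
    proof (intro mult_left_mono)
      have "\<gamma> \<le> 2 / real k" using k unfolding \<gamma>k by (intro divide_left_mono) auto
      then show "l \<le> 3 / real k" using l32 by simp
    qed (use L p in auto)
    also have "\<dots> = 3 * L / real k * p" by simp
    also have "\<dots> \<le> \<beta> * \<nu> * p" using \<beta>\<nu> p by (intro mult_right_mono) auto
    finally show ?thesis by (simp add: algebra_simps)
  qed
  define \<eta> where "\<eta> t = ags_alpha L M k t * (ags_beta L M \<nu> k
    + (ags_beta L M \<nu> k * ags_p L M k t + ags_q L M \<nu> k t))" for t
  \<comment> \<open>\<open>\<alpha> * (1 + p) = 1\<close>, so the Bregman weight keeps the value
    \<open>\<beta>\<close> during the whole call.\<close>
  have \<eta>: "\<eta> t = \<beta>" for t
    unfolding \<eta>_def P unfolding \<alpha> \<beta>_def[symmetric] using p by (simp add: field_simps)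
  have c6: "0 \<le> ags_beta L M \<nu> k * ags_p L M k t + ags_q L M \<nu> k t" for t
    unfolding P using \<beta> p by simp
  have c7': "M * ags_lambda L M k * ags_alpha L M k t
      \<le> \<nu> * (ags_beta L M \<nu> k * ags_p L M k t + ags_q L M \<nu> k t)" for t
    unfolding P unfolding \<alpha> l_def[symmetric] by (rule c7)
  have c9: "ags_alpha L M k (Suc t) * (ags_beta L M \<nu> k * ags_p L M k (Suc t) + ags_q L M \<nu> k (Suc t))
      = (1 - ags_alpha L M k (Suc t)) * \<eta> t" for t
    unfolding P \<alpha> \<alpha>' \<eta> by simp
  have c10: "ags_gamma k = ags_lambda L M k * (1 - (\<Prod>i=1..T. 1 - ags_alpha L M k i))"
    using T \<theta>0 unfolding \<alpha> \<alpha>' by (simp add: \<gamma>_def[symmetric] l_def[symmetric] lk \<theta>_def[symmetric])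
  have "L * \<gamma> \<le> 3 * L / real k" using L k by (simp add: \<gamma>k field_simps)
  then have c11: "L * ags_gamma k \<le> ags_beta L M \<nu> k * \<nu>"
    using \<beta>\<nu> by (simp add: \<gamma>_def \<beta>_def)
  have "l * \<beta> = 9 * L * \<gamma> / (2 * \<nu> * real k)" using l by (simp add: \<beta>k)
  also have "\<dots> = 9 * L / (\<nu> * (real k * (real k + 1)))"
    unfolding \<gamma>k using k \<nu>_pos by (simp add: divide_simps)
  finally have \<eta>T: "ags_lambda L M k * \<eta> T = 9 * L / (\<nu> * (real k * (real k + 1)))"
    by (simp add: \<eta> l_def)
  have c4: "0 < ags_alpha L M k t" "ags_alpha L M k t < 1" "ags_alpha L M k t \<le> 1" for t
    using p by (simp_all add: \<alpha>)
  have c1: "0 \<le> ags_lambda L M k" "ags_lambda L M k \<le> 1" "0 < ags_beta L M \<nu> k"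
    using l \<beta> by (simp_all add: l_def \<beta>_def)
  note step = outer_step[OF xb x c1 c4(1,3,2) c6 c7' \<eta>_def c9 T(1) c10 c11 run[folded T_def]]
  show "x' \<in> X" "xb' \<in> X" using step(1,2) by (simp_all add: xb'_def)
  assume "z \<in> X"
  from step(3)[OF this] show "f xb' + h xb' - (f z + h z) \<le>
      (1 - ags_gamma k) * (f xb + h xb - (f z + h z))
        + 9 * L / (\<nu> * (real k * (real k + 1))) * (V x z - V x' z)"
    by (simp add: xb'_def \<eta>T)
qed

text \<open>Multiplied by \<open>k * (k + 1)\<close>, every outer step has the same Bregman
  coefficient \<open>9 * L / \<nu>\<close>, while \<open>(k + 1) * (1 - \<gamma>_k) = k - 1\<close>
  turns the weight of the old gap into \<open>N * (N + 1)\<close> for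
  \<open>N = k - 1\<close>.\<close>

lemma ags_bound:
  assumes x0: "x0 \<in> X"
  defines "x \<equiv> \<lambda>N. fst (ags X V f df h L M \<nu> x0 N)"
  defines "xb \<equiv> \<lambda>N. fst (snd (ags X V f df h L M \<nu> x0 N))"
  shows "x N \<in> X \<and> xb N \<in> X \<and> (\<forall>z\<in>X. real N * (real N + 1) * (f (xb N) + h (xb N) - (f z + h z))
    + 9 * L / \<nu> * V (x N) z \<le> 9 * L / \<nu> * V x0 z)"
proof (induction N)
  case 0
  then show ?case using x0 by (simp add: x_def xb_def)
next
  case (Suc N)
  define k where "k = Suc N"
  obtain x' xt c where run: "(x', xt, c) = prox_ag X V h (ags_alpha L M k) (ags_p L M k)
      (ags_q L M \<nu> k) (lin f df ((1 - ags_gamma k) *\<^sub>R xb N + ags_gamma k *\<^sub>R x N)) (xb N) (x N)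
      (ags_lambda L M k) (ags_beta L M \<nu> k) (ags_T L M k)"
    by (metis prod_cases3)
  have x': "x (Suc N) = x'" "xb (Suc N) = (1 - ags_lambda L M k) *\<^sub>R xb N + ags_lambda L M k *\<^sub>R xt"
    using run[symmetric] by (simp_all add: x_def xb_def k_def Let_def case_prod_beta)
  have xN: "x N \<in> X" "xb N \<in> X" using Suc by auto
  have step: "x (Suc N) \<in> X \<and> xb (Suc N) \<in> X \<and> (\<forall>z\<in>X. f (xb (Suc N)) + h (xb (Suc N)) - (f z + h z) \<le>
      (1 - ags_gamma k) * (f (xb N) + h (xb N) - (f z + h z))
        + 9 * L / (\<nu> * (real k * (real k + 1))) * (V (x N) z - V (x (Suc N)) z))"
  proof (cases "N = 0")
    case True
    then have k: "k = 1" by (simp add: k_def)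
    \<comment> \<open>The coefficient \<open>9 * L / (2 * \<nu>)\<close> of the first call is the
      general one at \<open>k = 1\<close>.\<close>
    show ?thesis
      using ags_first_step[OF xN(2,1) run[unfolded k]] unfolding x' k by (simp add: mult.commute)
  next
    case False
    then have k: "2 \<le> k" by (simp add: k_def)
    show ?thesis
      using ags_later_step[OF k xN(2,1) run] unfolding x' by blast
  qed
  have "real k * (real k + 1) * (f (xb (Suc N)) + h (xb (Suc N)) - (f z + h z))
      + 9 * L / \<nu> * V (x (Suc N)) z \<le> 9 * L / \<nu> * V x0 z" if z: "z \<in> X" for z
  proof -
    define \<delta> where "\<delta> N = f (xb N) + h (xb N) - (f z + h z)" for N
    have kk: "real k > 0" by (simp add: k_def)
    have "real k * (real k + 1) * \<delta> (Suc N) \<le> real k * (real k + 1) * ((1 - ags_gamma k) * \<delta> N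
        + 9 * L / (\<nu> * (real k * (real k + 1))) * (V (x N) z - V (x (Suc N)) z))"
      using step z kk by (intro mult_left_mono) (auto simp: \<delta>_def)
    also have "\<dots> = real k * ((real k + 1) * (1 - ags_gamma k)) * \<delta> N
        + real k * (real k + 1) * (9 * L / (\<nu> * (real k * (real k + 1)))) * (V (x N) z - V (x (Suc N)) z)"
      by (simp only: algebra_simps)
    also have "(real k + 1) * (1 - ags_gamma k) = real k - 1"
      using kk by (simp add: ags_gamma_def field_simps)
    also have "real k * (real k + 1) * (9 * L / (\<nu> * (real k * (real k + 1)))) = 9 * L / \<nu>"
      using kk by simp
    finally have "real k * (real k + 1) * \<delta> (Suc N) \<le> real N * (real N + 1) * \<delta> N
        + 9 * L / \<nu> * (V (x N) z - V (x (Suc N)) z)"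
      by (simp add: k_def algebra_simps)
    moreover have "real N * (real N + 1) * \<delta> N + 9 * L / \<nu> * V (x N) z \<le> 9 * L / \<nu> * V x0 z"
      using Suc z by (simp add: \<delta>_def)
    ultimately show ?thesis by (simp add: \<delta>_def[symmetric] right_diff_distrib)
  qed
  then show ?case using step by (simp add: k_def)
qed

end

section \<open>Operator evaluations of one stage\<close>

lemma ags_counts:
  "fst (snd (snd (ags X V f df h L M \<nu> x0 N))) = N"
  "snd (snd (snd (ags X V f df h L M \<nu> x0 N))) = (\<Sum>k=1..N. 2 * ags_T L M k)"
  by (induction N) (simp_all add: Let_def case_prod_beta snd_snd_prox_ag)

lemma ln_3_le: "ln 3 \<le> (11 / 10 :: real)"
proof -
  \<comment> \<open>Seven terms of the exponential series at 11/10 already give about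
    3.0037.\<close>
  have "3 \<le> (\<Sum>k<7. (11 / 10 :: real) ^ k /\<^sub>R fact k)"
    by (simp add: numeral_eq_Suc fact_reduce)
  also have "\<dots> \<le> exp (11 / 10)"
    unfolding exp_def by (intro sum_le_suminf summable_exp_generic) auto
  finally have "ln 3 \<le> ln (exp (11 / 10 :: real))" by (subst ln_le_cancel_iff) auto
  then show ?thesis by simp
qed

text \<open>Both \<open>sqrt (8 / 7)\<close> and \<open>ln 3\<close> are at most 11/10, so every
  inner iteration count is at most \<open>21 / 10 + 11 / 10 * sqrt (M / L)\<close>; each inner
  iteration costs two evaluations.\<close>

lemma ags_operator_count:
  assumes LM: "L > 0" "M > 0"
  shows "real (snd (snd (snd (ags X V f df h L M \<nu> x0 N)))) \<le>
    real N * (42 / 10 + 22 / 10 * sqrt (M / L))"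
proof -
  let ?p = "sqrt (M / L)"
  have p: "?p > 0" using LM by simp
  have T: "real (ags_T L M k) \<le> 21 / 10 + 11 / 10 * ?p" for k
  proof (cases "k = 1")
    case True
    have "sqrt (8 * M / (7 * L)) = sqrt (8 / 7) * ?p" by (simp flip: real_sqrt_mult)
    also have "\<dots> \<le> 11 / 10 * ?p"
      using p by (intro mult_right_mono real_le_lsqrt) (auto simp: power2_eq_square)
    finally show ?thesis using ags_T_first(3)[OF LM] True by simp
  next
    case False
    have "(?p + 1) * ln 3 \<le> (?p + 1) * (11 / 10)"
      using p ln_3_le by (intro mult_left_mono) auto
    then show ?thesis using ags_T_later(3)[OF LM False] by (simp add: algebra_simps)
  qed
  have "real (\<Sum>k=1..N. 2 * ags_T L M k) = (\<Sum>k=1..N. 2 * real (ags_T L M k))" by simp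
  also have "\<dots> \<le> (\<Sum>k=1..N. 42 / 10 + 22 / 10 * ?p)"
    using T by (intro sum_mono) (simp add: field_simps)
  finally show ?thesis by (simp add: ags_counts)
qed

section \<open>Smoothing and the multi-stage method\<close>

lemma young_inequality:
  fixes a b c :: real
  assumes "c > 0"
  shows "a * b \<le> c / 2 * b\<^sup>2 + a\<^sup>2 / (2 * c)"
proof -
  have "0 \<le> (c * b - a)\<^sup>2 / (2 * c)" using assms by simp
  also have "\<dots> = c / 2 * b\<^sup>2 + a\<^sup>2 / (2 * c) - a * b"
    using assms by (simp add: power2_eq_square field_simps)
  finally show ?thesis by simp
qed

text \<open>Attainment includes \<open>\<rho> = 0\<close>, where the smoothed function is the max
  term of the original objective; the original and the smoothed problems can then be compared by the
  same lemmas.\<close>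

locale saddle_setting =
  fixes Y :: "'b::euclidean_space set" and nX :: "'a::euclidean_space \<Rightarrow> real" and nY :: "'b \<Rightarrow> real"
    and K :: "'a \<Rightarrow> 'b" and J :: "'b \<Rightarrow> real" and W :: "'b \<Rightarrow> 'b \<Rightarrow> real" and \<omega> :: real and y0 :: 'b
  assumes nX: "is_norm nX" and nY: "is_norm nY" and K: "linear K" and J: "convex_on Y J"
    and W: "prox_function nY Y \<omega> W" and y0: "y0 \<in> Y" and W_bdd: "bdd_above (W y0 ` Y)"
    and max_attained: "\<rho> \<ge> 0 \<Longrightarrow>
      \<exists>y\<in>Y. \<forall>z\<in>Y. K x \<bullet> z - J z - \<rho> * W y0 z \<le> K x \<bullet> y - J y - \<rho> * W y0 y"
begin

abbreviation h :: "real \<Rightarrow> 'a \<Rightarrow> real" where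
  "h \<equiv> smoothed K J Y W y0"

abbreviation \<Omega> :: real where
  "\<Omega> \<equiv> SUP v\<in>Y. W y0 v"

lemma \<omega>_pos: "\<omega> > 0"
  using W by (simp add: prox_function_def)

lemma W_nonneg: "z \<in> Y \<Longrightarrow> 0 \<le> W y0 z"
  by (rule prox_function_nonneg[OF W nY y0])

lemma W_le: "z \<in> Y \<Longrightarrow> W y0 z \<le> \<Omega>"
  by (rule cSUP_upper[OF _ W_bdd])

lemma \<Omega>_nonneg: "0 \<le> \<Omega>"
  using W_nonneg[OF y0] W_le[OF y0] by simp

lemma smoothed_maximizer:
  assumes "\<rho> \<ge> 0"
  obtains y where "y \<in> Y" "h \<rho> x = K x \<bullet> y - J y - \<rho> * W y0 y"
    "\<And>z. z \<in> Y \<Longrightarrow> K x \<bullet> z - J z - \<rho> * W y0 z \<le> h \<rho> x"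
proof -
  obtain y where y: "y \<in> Y" "\<forall>z\<in>Y. K x \<bullet> z - J z - \<rho> * W y0 z \<le> K x \<bullet> y - J y - \<rho> * W y0 y"
    using max_attained[OF assms] by blast
  then have "h \<rho> x = K x \<bullet> y - J y - \<rho> * W y0 y"
    unfolding smoothed_def by (intro cSup_eq_maximum) auto
  then show thesis using that y by auto
qed

lemma smoothed_antimono:
  assumes "0 \<le> \<rho>'" "\<rho>' \<le> \<rho>"
  shows "h \<rho> x \<le> h \<rho>' x" and "h \<rho>' x \<le> h \<rho> x + (\<rho> - \<rho>') * \<Omega>"
proof -
  have \<rho>: "0 \<le> \<rho>" using assms by simp
  obtain y where y: "y \<in> Y" "h \<rho> x = K x \<bullet> y - J y - \<rho> * W y0 y"
    "\<And>z. z \<in> Y \<Longrightarrow> K x \<bullet> z - J z - \<rho> * W y0 z \<le> h \<rho> x"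
    using smoothed_maximizer[OF \<rho>] by blast
  obtain y' where y': "y' \<in> Y" "h \<rho>' x = K x \<bullet> y' - J y' - \<rho>' * W y0 y'"
    "\<And>z. z \<in> Y \<Longrightarrow> K x \<bullet> z - J z - \<rho>' * W y0 z \<le> h \<rho>' x"
    using smoothed_maximizer[OF assms(1)] by blast
  have "\<rho>' * W y0 y \<le> \<rho> * W y0 y" using assms W_nonneg[OF y(1)] by (intro mult_right_mono)
  then show "h \<rho> x \<le> h \<rho>' x" using y'(3)[OF y(1)] y(2) by simp
  have "(\<rho> - \<rho>') * W y0 y' \<le> (\<rho> - \<rho>') * \<Omega>" using assms W_le[OF y'(1)] by (intro mult_left_mono) auto
  then show "h \<rho>' x \<le> h \<rho> x + (\<rho> - \<rho>') * \<Omega>"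
    using y(3)[OF y'(1)] y'(2) by (simp add: algebra_simps)
qed

text \<open>\<open>W y0\<close> is \<open>\<phi>\<close> minus an affine function on
  \<open>Y\<close> and inherits its strong convexity. \<open>J\<close> need not be differentiable,
  so optimality of \<open>y\<close> is tested at \<open>(1 - t) y + t z\<close>; dividing by
  \<open>t\<close> and letting \<open>t\<close> tend to 0 recovers the full quadratic term.\<close>

lemma maximizer_strong_concavity:
  assumes \<rho>: "\<rho> \<ge> 0" and y: "y \<in> Y"
    and max: "\<And>z. z \<in> Y \<Longrightarrow> K x \<bullet> z - J z - \<rho> * W y0 z \<le> K x \<bullet> y - J y - \<rho> * W y0 y"
    and z: "z \<in> Y"
  shows "K x \<bullet> z - J z - \<rho> * W y0 z + \<rho> * \<omega> / 2 * (nY (y - z))\<^sup>2 \<le> K x \<bullet> y - J y - \<rho> * W y0 y"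
proof -
  obtain \<phi> d\<phi> where \<phi>: "strongly_convex_on nY Y \<omega> \<phi>"
    and Weq: "\<And>z. z \<in> Y \<Longrightarrow> W y0 z = \<phi> z - \<phi> y0 - d\<phi> y0 \<bullet> (z - y0)"
    using W y0 unfolding prox_function_def by blast
  have cvx: "convex Y" using \<phi> by (simp add: strongly_convex_on_def)
  define \<Psi> where "\<Psi> z = K x \<bullet> z - J z - \<rho> * W y0 z" for z
  define q where "q = \<rho> * \<omega> / 2 * (nY (y - z))\<^sup>2"
  have "\<Psi> z + (1 - t) * q \<le> \<Psi> y" if t: "0 < t" "t < 1" for t
  proof -
    define w where "w = (1 - t) *\<^sub>R y + t *\<^sub>R z"
    have w: "w \<in> Y" unfolding w_def using cvx y z t by (intro convexD_alt) auto
    have "\<phi> w \<le> (1 - t) * \<phi> y + t * \<phi> z - \<omega> / 2 * t * (1 - t) * (nY (y - z))\<^sup>2"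
      using \<phi> y z t by (simp add: strongly_convex_on_def w_def)
    moreover have "d\<phi> y0 \<bullet> w = (1 - t) * (d\<phi> y0 \<bullet> y) + t * (d\<phi> y0 \<bullet> z)"
      by (simp add: inner_add_right w_def)
    ultimately have "W y0 w \<le> (1 - t) * W y0 y + t * W y0 z - \<omega> / 2 * t * (1 - t) * (nY (y - z))\<^sup>2"
      by (simp add: Weq w y z inner_diff_right algebra_simps)
    from mult_left_mono[OF this \<rho>]
    have "\<rho> * W y0 w \<le> (1 - t) * (\<rho> * W y0 y) + t * (\<rho> * W y0 z) - t * ((1 - t) * q)"
      by (simp add: q_def algebra_simps)
    moreover have "J w \<le> (1 - t) * J y + t * J z"
      using convex_onD[OF J, of t y z] y z t by (simp add: w_def)
    moreover have "K x \<bullet> w = (1 - t) * (K x \<bullet> y) + t * (K x \<bullet> z)"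
      by (simp add: inner_add_right w_def)
    moreover have "\<Psi> w \<le> \<Psi> y" using max[OF w] by (simp add: \<Psi>_def)
    ultimately have "t * (\<Psi> z + (1 - t) * q) \<le> t * \<Psi> y"
      by (simp add: \<Psi>_def algebra_simps)
    then show ?thesis using t by simp
  qed
  then have "\<forall>\<^sub>F t in at_right 0. \<Psi> z + (1 - t) * q \<le> \<Psi> y"
    by (auto simp: eventually_at_right_field intro!: exI[of _ 1])
  moreover have "((\<lambda>t::real. \<Psi> z + (1 - t) * q) \<longlongrightarrow> \<Psi> z + (1 - 0) * q) (at_right 0)"
    by (intro tendsto_intros)
  ultimately have "\<Psi> z + (1 - 0) * q \<le> \<Psi> y"
    by (intro tendsto_upperbound) auto
  then show ?thesis by (simp add: \<Psi>_def q_def)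
qed

text \<open>Danskin's formula with Nesterov's estimate. The maximizer \<open>y\<close> for
  \<open>u\<close> competes at \<open>x\<close>, which gives the lower bound with slope
  \<open>adjoint K y\<close>. The maximizer \<open>z\<close> for \<open>x\<close> falls short at
  \<open>u\<close> by at least \<open>\<rho> * \<omega> / 2\<close> times the square of
  \<open>nY (y - z)\<close>, and Young's inequality trades this loss against
  \<open>K (x - u) \<bullet> (z - y)\<close>. The derivative then follows by squeezing the
  remainder.\<close>

lemma smoothed_gradient:
  assumes \<rho>: "\<rho> > 0"
  shows "GDERIV (h \<rho>) u :> grad (h \<rho>) u"
    and "lin (h \<rho>) (grad (h \<rho>)) u x \<le> h \<rho> x"
    and "h \<rho> x \<le> lin (h \<rho>) (grad (h \<rho>)) u x + (op_norm nX nY K)\<^sup>2 / (\<rho> * \<omega>) / 2 * (nX (x - u))\<^sup>2"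
proof -
  let ?M = "(op_norm nX nY K)\<^sup>2 / (\<rho> * \<omega>)"
  obtain y where y: "y \<in> Y" "h \<rho> u = K u \<bullet> y - J y - \<rho> * W y0 y"
    "\<And>z. z \<in> Y \<Longrightarrow> K u \<bullet> z - J z - \<rho> * W y0 z \<le> h \<rho> u"
    using smoothed_maximizer[of \<rho> u, OF less_imp_le[OF \<rho>]] by blast
  have max: "K u \<bullet> w - J w - \<rho> * W y0 w \<le> K u \<bullet> y - J y - \<rho> * W y0 y" if "w \<in> Y" for w
    using y(3)[OF that] y(2) by linarith
  define D where "D = adjoint K y"
  have D: "D \<bullet> d = K d \<bullet> y" for d
    unfolding D_def adjoint_clauses(2)[OF K] by (rule inner_commute)
  have lower: "h \<rho> u + D \<bullet> (x - u) \<le> h \<rho> x" for x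
  proof -
    have "\<And>z. z \<in> Y \<Longrightarrow> K x \<bullet> z - J z - \<rho> * W y0 z \<le> h \<rho> x"
      by (rule smoothed_maximizer[of \<rho> x, OF less_imp_le[OF \<rho>]])
    from this[OF y(1)] show ?thesis
      unfolding D y(2) by (simp add: linear_diff[OF K] inner_diff_left)
  qed
  have upper: "h \<rho> x \<le> h \<rho> u + D \<bullet> (x - u) + ?M / 2 * (nX (x - u))\<^sup>2" for x
  proof -
    obtain z where z: "z \<in> Y" "h \<rho> x = K x \<bullet> z - J z - \<rho> * W y0 z"
      "\<And>w. w \<in> Y \<Longrightarrow> K x \<bullet> w - J w - \<rho> * W y0 w \<le> h \<rho> x"
      using smoothed_maximizer[of \<rho> x, OF less_imp_le[OF \<rho>]] by blast
    define a where "a = op_norm nX nY K * nX (x - u)"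
    define b where "b = nY (y - z)"
    have c: "\<rho> * \<omega> > 0" using \<rho> \<omega>_pos by simp
    have "K u \<bullet> z - J z - \<rho> * W y0 z + \<rho> * \<omega> / 2 * b\<^sup>2 \<le> h \<rho> u"
      unfolding y(2) b_def by (rule maximizer_strong_concavity[OF less_imp_le[OF \<rho>] y(1) max z(1)])
    moreover have "K (x - u) \<bullet> (z - y) \<le> a * b"
      using op_norm_bound[OF nX nY K, of "x - u" "z - y"]
      by (simp add: a_def b_def is_norm_minus_commute[OF nY, of y])
    moreover have "a * b \<le> \<rho> * \<omega> / 2 * b\<^sup>2 + a\<^sup>2 / (2 * (\<rho> * \<omega>))"
      using c by (rule young_inequality)
    moreover have "?M / 2 * (nX (x - u))\<^sup>2 = a\<^sup>2 / (2 * (\<rho> * \<omega>))"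
      by (simp add: a_def power_mult_distrib)
    moreover have "K (x - u) \<bullet> (z - y) = K x \<bullet> z - K u \<bullet> z - D \<bullet> (x - u)"
      by (simp add: D linear_diff[OF K] inner_diff_left inner_diff_right)
    ultimately show ?thesis unfolding z(2) by linarith
  qed
  \<comment> \<open>The remainder is bounded in \<open>nX\<close>, but the derivative refers to the
    Euclidean norm.\<close>
  obtain C where C: "C > 0" "\<And>x. nX x \<le> C * norm x" using is_norm_upper_bound[OF nX] by blast
  have "((\<lambda>x. norm (h \<rho> x - h \<rho> u - (x - u) \<bullet> D) / norm (x - u)) \<longlongrightarrow> 0) (at u)"
  proof (rule Lim_null_comparison)
    have "norm (norm (h \<rho> x - h \<rho> u - (x - u) \<bullet> D) / norm (x - u)) \<le> ?M / 2 * C\<^sup>2 * norm (x - u)" for x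
    proof (cases "x = u")
      case False
      have "\<bar>h \<rho> x - h \<rho> u - (x - u) \<bullet> D\<bar> \<le> ?M / 2 * (nX (x - u))\<^sup>2"
        using lower[of x] upper[of x] inner_commute[of "x - u" D] by linarith
      also have "\<dots> \<le> ?M / 2 * (C * norm (x - u))\<^sup>2"
        using \<rho> \<omega>_pos C(2) by (intro mult_left_mono power_mono is_norm_nonneg[OF nX]) auto
      also have "\<dots> = ?M / 2 * C\<^sup>2 * norm (x - u) * norm (x - u)"
        by (simp only: power_mult_distrib power2_eq_square mult.assoc mult.left_commute)
      finally have "\<bar>h \<rho> x - h \<rho> u - (x - u) \<bullet> D\<bar> \<le> ?M / 2 * C\<^sup>2 * norm (x - u) * norm (x - u)" .
      then show ?thesis using False by (simp add: pos_divide_le_eq)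
    qed simp
    then show "\<forall>\<^sub>F x in at u. norm (norm (h \<rho> x - h \<rho> u - (x - u) \<bullet> D) / norm (x - u))
        \<le> ?M / 2 * C\<^sup>2 * norm (x - u)" by simp
    have "((\<lambda>x. ?M / 2 * C\<^sup>2 * norm (x - u)) \<longlongrightarrow> ?M / 2 * C\<^sup>2 * norm (u - u)) (at u)"
      by (intro tendsto_intros)
    then show "((\<lambda>x. ?M / 2 * C\<^sup>2 * norm (x - u)) \<longlongrightarrow> 0) (at u)" by simp
  qed
  then have der: "GDERIV (h \<rho>) u :> D"
    unfolding gderiv_def has_derivative_iff_norm by (simp add: bounded_linear_inner_left)
  \<comment> \<open>\<open>grad\<close> is a definite description, so it returns \<open>D\<close>
    only if \<open>D\<close> is the one gradient.\<close>
  have uniq: "D' = D" if "GDERIV (h \<rho>) u :> D'" for D'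
  proof -
    have "(\<lambda>d. d \<bullet> D') = (\<lambda>d. d \<bullet> D)"
      using that der unfolding gderiv_def by (rule has_derivative_unique)
    from fun_cong[OF this] have "\<forall>d. d \<bullet> D' = d \<bullet> D" by blast
    then show ?thesis by (simp only: vector_eq_ldot)
  qed
  have grad: "grad (h \<rho>) u = D"
    unfolding grad_def using der uniq by (rule the_equality)
  show "GDERIV (h \<rho>) u :> grad (h \<rho>) u" using der by (simp only: grad)
  show "lin (h \<rho>) (grad (h \<rho>)) u x \<le> h \<rho> x" using lower by (simp only: lin_def grad)
  show "h \<rho> x \<le> lin (h \<rho>) (grad (h \<rho>)) u x + ?M / 2 * (nX (x - u))\<^sup>2"
    using upper by (simp only: lin_def grad)
qed

end

section \<open>Cost and accuracy over the stages\<close>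

lemma ms_ags_gradient_count:
  "fst (snd (ms_ags X V f df hs L Ms \<nu> \<rho>0 N0 v0 S)) = N0 * S"
  by (induction S) (simp_all add: Let_def case_prod_beta ags_counts)

lemma ms_ags_operator_count:
  assumes "L > 0" "\<And>\<rho>. \<rho> > 0 \<Longrightarrow> Ms \<rho> > 0" "\<rho>0 > 0"
  shows "real (snd (snd (ms_ags X V f df hs L Ms \<nu> \<rho>0 N0 v0 S))) \<le>
    (\<Sum>s=1..S. real N0 * (42 / 10 + 22 / 10 * sqrt (Ms (2 powr (- (real s / 2)) * \<rho>0) / L)))"
proof -
  define c where "c s = real N0 * (42 / 10 + 22 / 10 * sqrt (Ms (2 powr (- (real s / 2)) * \<rho>0) / L))"
    for s :: nat
  have "real (snd (snd (ms_ags X V f df hs L Ms \<nu> \<rho>0 N0 v0 S))) \<le> (\<Sum>s=1..S. c s)"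
  proof (induction S)
    case (Suc S)
    let ?\<rho> = "2 powr (- (real (Suc S) / 2)) * \<rho>0"
    have "Ms ?\<rho> > 0" using assms by simp
    then have "real (snd (snd (snd (ags X V f df (hs ?\<rho>) L (Ms ?\<rho>) \<nu>
        (fst (ms_ags X V f df hs L Ms \<nu> \<rho>0 N0 v0 S)) N0)))) \<le> c (Suc S)"
      unfolding c_def by (rule ags_operator_count[OF assms(1)])
    with Suc show ?case
      by (simp add: Let_def case_prod_beta del: of_nat_Suc)
  qed simp
  then show ?thesis by (simp only: c_def)
qed

locale multistage_setting = saddle_setting Y nX nY K J W \<omega> y0
  for Y :: "'b::euclidean_space set" and nX :: "'a::euclidean_space \<Rightarrow> real" and nY K J W \<omega> y0 +
  fixes X :: "'a set" and V :: "'a \<Rightarrow> 'a \<Rightarrow> real" and f :: "'a \<Rightarrow> real" and df :: "'a \<Rightarrow> 'a"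
    and L \<mu> \<nu> :: real
  assumes closed: "closed X" and cvx: "convex X" and df: "has_gradient_on f df X"
    and L: "L > 0" and \<mu>: "\<mu> > 0"
    and f_bounds: "x \<in> X \<Longrightarrow> u \<in> X \<Longrightarrow> \<mu> / 2 * (nX (x - u))\<^sup>2 \<le> f x - lin f df u x \<and>
         f x - lin f df u x \<le> L / 2 * (nX (x - u))\<^sup>2"
    and V: "prox_function nX X \<nu> V"
    and V_le: "x \<in> X \<Longrightarrow> u \<in> X \<Longrightarrow> V x u \<le> 1 / 2 * (nX (x - u))\<^sup>2"
begin

abbreviation M :: "real \<Rightarrow> real" where
  "M \<equiv> \<lambda>\<rho>. (op_norm nX nY K)\<^sup>2 / (\<rho> * \<omega>)"

lemma \<nu>_pos: "\<nu> > 0"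
  using V by (simp add: prox_function_def)

text \<open>\<open>low\<close> serves twice. At \<open>v\<close> it is the growth that yields a
  minimizer on a possibly unbounded \<open>X\<close>; at the minimizer \<open>m\<close> its linear
  term is nonnegative by optimality, which leaves quadratic growth around \<open>m\<close>.\<close>

lemma smoothed_problem_minimizer:
  assumes \<rho>: "\<rho> > 0" and v: "v \<in> X"
  obtains m where "m \<in> X"
    "\<And>x. x \<in> X \<Longrightarrow> f m + h \<rho> m + \<mu> / 2 * (nX (x - m))\<^sup>2 \<le> f x + h \<rho> x"
proof -
  have der: "((\<lambda>x. f x + h \<rho> x) has_derivative (\<lambda>d. df x \<bullet> d + d \<bullet> grad (h \<rho>) x)) (at x within X)"
    if "x \<in> X" for x
  proof (rule has_derivative_add)
    show "(f has_derivative (\<lambda>d. df x \<bullet> d)) (at x within X)"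
      using df that by (simp add: has_gradient_on_def)
    show "(h \<rho> has_derivative (\<lambda>d. d \<bullet> grad (h \<rho>) x)) (at x within X)"
      using smoothed_gradient(1)[OF \<rho>, of x] unfolding gderiv_def
      by (rule has_derivative_at_withinI)
  qed
  have cont: "continuous_on X (\<lambda>x. f x + h \<rho> x)"
    unfolding continuous_on_eq_continuous_within
    using has_derivative_continuous[OF der] by blast
  have low: "(f v + h \<rho> v) + (df v + grad (h \<rho>) v) \<bullet> (z - v) + \<mu> / 2 * (nX (z - v))\<^sup>2
      \<le> f z + h \<rho> z" if "z \<in> X" "v \<in> X" for z v
    using f_bounds[OF that] smoothed_gradient(2)[OF \<rho>, of v z]
    unfolding lin_def inner_add_left by linarith
  obtain m where m: "m \<in> X" "\<And>z. z \<in> X \<Longrightarrow> f m + h \<rho> m \<le> f z + h \<rho> z"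
    using coercive_attains_min[OF closed v cont nX half_gt_zero[OF \<mu>] low[OF _ v]] by blast
  have "f m + h \<rho> m + \<mu> / 2 * (nX (x - m))\<^sup>2 \<le> f x + h \<rho> x" if x: "x \<in> X" for x
    using min_variational_inequality[OF cvx m(1) x der[OF m(1)] m(2)] low[OF x m(1)]
    unfolding inner_add_left inner_commute[of "x - m"] by linarith
  then show thesis using that m(1) by blast
qed

text \<open>This gives the optimal value its meaning, since \<open>INF\<close> of an unbounded set
  of reals is unspecified. The minimum for \<open>\<rho> = 1\<close> is a lower bound because
  \<open>h 1 \<le> h 0\<close>.\<close>

lemma bdd_below_problem:
  assumes "v \<in> X"
  shows "bdd_below ((\<lambda>x. f x + h 0 x) ` X)"
proof -
  obtain m where m: "\<And>x. x \<in> X \<Longrightarrow> f m + h 1 m + \<mu> / 2 * (nX (x - m))\<^sup>2 \<le> f x + h 1 x"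
    using smoothed_problem_minimizer[OF zero_less_one assms] by blast
  have "f m + h 1 m \<le> f x + h 0 x" if "x \<in> X" for x
  proof -
    have "0 \<le> \<mu> / 2 * (nX (x - m))\<^sup>2" using \<mu> by simp
    then show ?thesis using m[OF that] smoothed_antimono(1)[of 0 1 x] by linarith
  qed
  then show ?thesis by (intro bdd_belowI2)
qed

text \<open>With \<open>m\<close> the minimizer and \<open>g\<close> the initial gap to it,
  \<open>9 * L / \<nu> * V v m\<close> is at most \<open>9 * L / (\<nu> * \<mu>) * g\<close>: bound
  \<open>V\<close> by half the squared norm and that by quadratic growth at \<open>m\<close>. The
  choice of \<open>N\<close> gives \<open>N\<^sup>2 \<ge> 18 * L / (\<nu> * \<mu>)\<close>, so this
  is at most \<open>N\<^sup>2 / 2 * g\<close>.\<close>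

lemma stage_halves_gap:
  assumes \<rho>: "\<rho> > 0" and K0: "op_norm nX nY K \<noteq> 0" and v: "v \<in> X"
    and N: "3 * sqrt (2 * L / (\<nu> * \<mu>)) \<le> real N"
    and gap: "\<And>z. z \<in> X \<Longrightarrow> f v + h \<rho> v - (f z + h \<rho> z) \<le> e"
  defines "v' \<equiv> fst (snd (ags X V f df (h \<rho>) L (M \<rho>) \<nu> v N))"
  shows "v' \<in> X" and "z \<in> X \<Longrightarrow> f v' + h \<rho> v' - (f z + h \<rho> z) \<le> e / 2"
proof -
  interpret ags_setting X nX V f df "h \<rho>" L "M \<rho>" \<nu>
  proof
    show "lin f df u x \<le> f x" if "x \<in> X" "u \<in> X" for x u
    proof -
      have "0 \<le> \<mu> / 2 * (nX (x - u))\<^sup>2" using \<mu> by simp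
      then show ?thesis using f_bounds[OF that] by linarith
    qed
    show "f x \<le> lin f df u x + L / 2 * (nX (x - u))\<^sup>2" if "x \<in> X" "u \<in> X" for x u
      using f_bounds[OF that] by linarith
    \<comment> \<open>For a vanishing operator \<open>M\<close> would be 0 and the first call of
      ProxAG would perform no iteration.\<close>
    show "M \<rho> > 0" using K0 \<rho> \<omega>_pos by simp
  qed (rule closed cvx nX V L smoothed_gradient(2,3)[OF \<rho>])+
  obtain m where m: "m \<in> X"
    "\<And>x. x \<in> X \<Longrightarrow> f m + h \<rho> m + \<mu> / 2 * (nX (x - m))\<^sup>2 \<le> f x + h \<rho> x"
    using smoothed_problem_minimizer[OF \<rho> v] by blast
  define g where "g = f v + h \<rho> v - (f m + h \<rho> m)"
  define \<delta> where "\<delta> = f v' + h \<rho> v' - (f m + h \<rho> m)"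
  note B = ags_bound[OF v, of N, folded v'_def]
  then show v': "v' \<in> X" by blast
  define x where "x = fst (ags X V f df (h \<rho>) L (M \<rho>) \<nu> v N)"
  have x: "x \<in> X" using B by (simp add: x_def)
  have LM: "L / (\<nu> * \<mu>) > 0" using L \<mu> \<nu>_pos by simp
  have "0 < 3 * sqrt (2 * L / (\<nu> * \<mu>))" using L \<mu> \<nu>_pos by simp
  then have N0: "real N > 0" using N by linarith
  have "(3 * sqrt (2 * L / (\<nu> * \<mu>)))\<^sup>2 \<le> (real N)\<^sup>2"
    using N LM by (intro power_mono) auto
  then have N2: "18 * (L / (\<nu> * \<mu>)) \<le> real N * real N"
    using L \<mu> \<nu>_pos by (simp add: power_mult_distrib) (simp add: power2_eq_square)
  have "0 \<le> 9 * L / \<nu> * V x m"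
    using prox_function_nonneg[OF V nX x m(1)] L \<nu>_pos by simp
  moreover have "real N * (real N + 1) * \<delta> + 9 * L / \<nu> * V x m \<le> 9 * L / \<nu> * V v m"
    using B m(1) unfolding \<delta>_def x_def by blast
  ultimately have "real N * (real N + 1) * \<delta> \<le> 9 * L / \<nu> * V v m" by linarith
  also have "\<dots> \<le> 9 * L / \<nu> * (1 / 2 * (nX (v - m))\<^sup>2)"
    using V_le[OF v m(1)] L \<nu>_pos by (intro mult_left_mono) auto
  also have "\<dots> = 9 * (L / (\<nu> * \<mu>)) * (\<mu> / 2 * (nX (v - m))\<^sup>2)" using \<mu> by simp
  also have "\<dots> \<le> 9 * (L / (\<nu> * \<mu>)) * g"
    using m(2)[OF v] LM by (intro mult_left_mono) (auto simp: g_def)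
  also have "\<dots> \<le> (real N * real N / 2) * g"
  proof -
    have "0 \<le> \<mu> / 2 * (nX (v - m))\<^sup>2" using \<mu> by simp
    then have "0 \<le> g" using m(2)[OF v] by (simp add: g_def)
    then show ?thesis using N2 by (intro mult_right_mono) auto
  qed
  finally have main: "real N * ((real N + 1) * \<delta>) \<le> real N * (real N * (g / 2))" by simp
  then have main: "(real N + 1) * \<delta> \<le> real N * (g / 2)" using N0 by simp
  have "0 \<le> \<mu> / 2 * (nX (v' - m))\<^sup>2" using \<mu> by simp
  then have "0 \<le> \<delta>" using m(2)[OF v'] by (simp add: \<delta>_def)
  then have "real N * \<delta> \<le> real N * (g / 2)" using main by (simp add: algebra_simps)
  then have "\<delta> \<le> g / 2" using N0 by simp
  also have "g \<le> e" using gap[OF m(1)] by (simp add: g_def)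
  finally have \<delta>: "\<delta> \<le> e / 2" by simp
  assume z: "z \<in> X"
  have "0 \<le> \<mu> / 2 * (nX (z - m))\<^sup>2" using \<mu> by simp
  then show "f v' + h \<rho> v' - (f z + h \<rho> z) \<le> e / 2"
    using \<delta> m(2)[OF z] by (simp add: \<delta>_def)
qed

text \<open>Lowering \<open>\<rho> S\<close> to \<open>\<rho> (Suc S)\<close> adds at most the
  difference times \<open>\<Omega>\<close> to the gap. As
  \<open>\<rho> S = sqrt 2 * \<rho> (Suc S)\<close>, halving leaves the coefficient
  \<open>(2 * sqrt 2 - 1) / 2\<close>, which is below 1, so the invariant reproduces itself.\<close>

lemma multistage_gap:
  assumes \<rho>0: "\<rho>0 > 0" and K0: "op_norm nX nY K \<noteq> 0" and v0: "v0 \<in> X"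
    and N: "3 * sqrt (2 * L / (\<nu> * \<mu>)) \<le> real N0"
    and gap: "\<And>z. z \<in> X \<Longrightarrow> f v0 + h 0 v0 - (f z + h 0 z) \<le> \<Delta>0"
  defines "v \<equiv> \<lambda>S. fst (ms_ags X V f df h L M \<nu> \<rho>0 N0 v0 S)"
  defines "\<rho> \<equiv> \<lambda>S. 2 powr (- (real S / 2)) * \<rho>0"
  shows "v S \<in> X \<and> (\<forall>z\<in>X. f (v S) + h (\<rho> S) (v S) - (f z + h (\<rho> S) z) \<le> \<Delta>0 / 2 ^ S + \<rho> S * \<Omega>)"
proof (induction S)
  case 0
  \<comment> \<open>\<open>\<Delta>0\<close> bounds the gap of the unsmoothed objective; smoothing
    lowers the value at \<open>z\<close> by at most \<open>\<rho>0 * \<Omega>\<close>.\<close>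
  have "f v0 + h \<rho>0 v0 - (f z + h \<rho>0 z) \<le> \<Delta>0 + \<rho>0 * \<Omega>" if "z \<in> X" for z
    using gap[OF that] smoothed_antimono[of 0 \<rho>0 v0] smoothed_antimono[of 0 \<rho>0 z] \<rho>0 by simp
  then show ?case using v0 by (simp add: v_def \<rho>_def)
next
  case (Suc S)
  have pos: "\<rho> (Suc S) > 0" using \<rho>0 by (simp add: \<rho>_def)
  have "- (real S / 2) = 1 / 2 + - (real (Suc S) / 2)" by (simp add: field_simps)
  then have \<rho>S: "\<rho> S = sqrt 2 * \<rho> (Suc S)"
    by (simp only: \<rho>_def powr_add powr_half_sqrt mult.assoc)
  have sqrt2: "1 \<le> sqrt (2::real)" "sqrt (2::real) \<le> 3 / 2"
    by simp (rule real_le_lsqrt, auto simp: power2_eq_square)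
  have le: "\<rho> (Suc S) \<le> \<rho> S" using sqrt2 pos by (simp add: \<rho>S)
  define e where "e = \<Delta>0 / 2 ^ S + \<rho> S * \<Omega> + (\<rho> S - \<rho> (Suc S)) * \<Omega>"
  have g: "f (v S) + h (\<rho> (Suc S)) (v S) - (f z + h (\<rho> (Suc S)) z) \<le> e" if "z \<in> X" for z
  proof -
    have "f (v S) + h (\<rho> S) (v S) - (f z + h (\<rho> S) z) \<le> \<Delta>0 / 2 ^ S + \<rho> S * \<Omega>"
      using Suc that by blast
    moreover have "h (\<rho> (Suc S)) (v S) \<le> h (\<rho> S) (v S) + (\<rho> S - \<rho> (Suc S)) * \<Omega>"
      "h (\<rho> S) z \<le> h (\<rho> (Suc S)) z"
      using smoothed_antimono[OF less_imp_le[OF pos] le] by blast+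
    ultimately show ?thesis unfolding e_def by linarith
  qed
  have vS: "v (Suc S) = fst (snd (ags X V f df (h (\<rho> (Suc S))) L (M (\<rho> (Suc S))) \<nu> (v S) N0))"
    by (simp add: v_def \<rho>_def Let_def case_prod_beta)
  have "e / 2 = \<Delta>0 / 2 ^ Suc S + (sqrt 2 - 1 / 2) * (\<rho> (Suc S) * \<Omega>)"
    by (simp add: e_def \<rho>S field_simps)
  also have "\<dots> \<le> \<Delta>0 / 2 ^ Suc S + 1 * (\<rho> (Suc S) * \<Omega>)"
    using sqrt2 pos \<Omega>_nonneg by (intro add_left_mono mult_right_mono) auto
  finally have e: "e / 2 \<le> \<Delta>0 / 2 ^ Suc S + \<rho> (Suc S) * \<Omega>" by simp
  have "v S \<in> X" using Suc by blast
  note stage = stage_halves_gap[OF pos K0 this N g, folded vS]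
  have "f (v (Suc S)) + h (\<rho> (Suc S)) (v (Suc S)) - (f z + h (\<rho> (Suc S)) z)
      \<le> \<Delta>0 / 2 ^ Suc S + \<rho> (Suc S) * \<Omega>" if "z \<in> X" for z
    using stage(2)[OF _ that] e by linarith
  then show ?case using stage(1) by blast
qed

end

section \<open>Constants of the operator bound\<close>

lemma sum_powr_quarter_le: "(\<Sum>s=1..S. 2 powr (real s / 4)) \<le> 7 * (2::real) powr (real S / 4)"
proof (induction S)
  case (Suc S)
  \<comment> \<open>With ratio \<open>r = 2 powr (1 / 4)\<close>, the constant 7 survives the
    induction step if \<open>7 \<le> 6 * r\<close>, and \<open>(7 / 6) ^ 4\<close> is below
    2.\<close>
  have "((2::real) powr (1 / 4)) ^ 4 = 2" by (simp add: powr_power)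
  then have "((7::real) / 6) ^ 4 \<le> (2 powr (1 / 4)) ^ 4" by (simp add: power_divide)
  then have r: "7 / 6 \<le> (2::real) powr (1 / 4)" by (subst (asm) power_mono_iff) auto
  have "real (Suc S) / 4 = real S / 4 + 1 / 4" by simp
  then have eq: "(2::real) powr (real (Suc S) / 4) = 2 powr (real S / 4) * 2 powr (1 / 4)"
    by (simp only: powr_add)
  have "7 * 2 powr (real S / 4) = 6 * (2 powr (real S / 4) * (7 / 6 :: real))" by simp
  also have "\<dots> \<le> 6 * (2 powr (real S / 4) * 2 powr (1 / 4))"
    using r by (intro mult_left_mono) auto
  finally have "7 * 2 powr (real S / 4) \<le> 6 * (2::real) powr (real (Suc S) / 4)"
    by (simp only: eq)
  moreover have "(\<Sum>s=1..Suc S. 2 powr (real s / 4)) =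
      (\<Sum>s=1..S. 2 powr (real s / 4)) + (2::real) powr (real (Suc S) / 4)" by simp
  ultimately show ?case using Suc by linarith
qed simp

text \<open>The quotient in front of the bound isolates the effect of rounding the iteration limit
  up; it is 1 for an exact limit.\<close>

lemma multistage_operator_count_le:
  fixes L \<nu> \<mu> \<omega> \<Delta>0 \<Omega> \<kappa> :: real and N S :: nat
  assumes pos: "L > 0" "\<nu> > 0" "\<mu> > 0" "\<omega> > 0" "\<Delta>0 > 0" "\<Omega> > 0" and \<kappa>: "\<kappa> \<ge> 0"
  defines "\<rho>0 \<equiv> 4 * \<Delta>0 / (\<Omega> * 2 powr (real S / 2))"
  shows "(\<Sum>s=1..S. real N * (42 / 10 + 22 / 10 *
      sqrt (\<kappa>\<^sup>2 / (2 powr (- (real s / 2)) * \<rho>0 * \<omega>) / L))) \<le>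
    real N / (3 * sqrt (2 * L / (\<nu> * \<mu>))) * (18 * sqrt (L / (\<nu> * \<mu>)) * real S
      + 56 * sqrt \<Omega> * \<kappa> / sqrt (\<mu> * \<Delta>0 * \<nu> * \<omega>) * 2 powr (real S / 2))"
proof -
  define A where "A = (2::real) powr (real S / 4)"
  define Q where "Q = sqrt \<Omega> * \<kappa> / sqrt (L * \<Delta>0 * \<omega>)"
  define R where "R = sqrt (L / (\<nu> * \<mu>))"
  have A: "A > 0" by (simp add: A_def)
  have A2: "2 powr (real S / 2) = A\<^sup>2" by (simp add: A_def powr_power)
  have R: "R > 0" using pos by (simp add: R_def)
  have Q: "Q \<ge> 0" using pos \<kappa> by (simp add: Q_def)
  have Q2: "Q\<^sup>2 = \<Omega> * \<kappa>\<^sup>2 / (L * \<Delta>0 * \<omega>)"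
    using pos by (simp add: Q_def power_mult_distrib power_divide)
  \<comment> \<open>The factor \<open>A\<close> stems from \<open>\<rho>0\<close> and the other
    power from stage \<open>s\<close>. The geometric sum over \<open>s\<close> contributes a second
    \<open>A\<close>, and \<open>A\<^sup>2\<close> is the \<open>2 powr (S / 2)\<close> of the
    claim.\<close>
  have term_eq: "sqrt (\<kappa>\<^sup>2 / (2 powr (- (real s / 2)) * \<rho>0 * \<omega>) / L) = Q / 2 * A * 2 powr (real s / 4)"
    for s :: nat
  proof -
    define B where "B = (2::real) powr (real s / 4)"
    have B: "B > 0" by (simp add: B_def)
    have B2: "2 powr (- (real s / 2)) = 1 / B\<^sup>2" by (simp add: B_def powr_power powr_minus_divide)
    have "\<kappa>\<^sup>2 / (2 powr (- (real s / 2)) * \<rho>0 * \<omega>) / L = Q\<^sup>2 * A\<^sup>2 * B\<^sup>2 / 4"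
      unfolding B2 Q2 \<rho>0_def A2 using pos A B by (simp add: field_simps)
    also have "\<dots> = (Q / 2 * A * B)\<^sup>2" by (simp add: power_mult_distrib power_divide)
    finally show ?thesis using Q A B by (simp add: B_def)
  qed
  have "(\<Sum>s=1..S. real N * (42 / 10 + 22 / 10 *
      sqrt (\<kappa>\<^sup>2 / (2 powr (- (real s / 2)) * \<rho>0 * \<omega>) / L))) =
      real N * (42 / 10 * real S + 11 / 10 * Q * A * (\<Sum>s=1..S. 2 powr (real s / 4)))"
  proof -
    have "42 / 10 + 22 / 10 * (Q / 2 * A * w) = 42 / 10 + 11 / 10 * Q * A * w" for w
      by simp
    then show ?thesis
      unfolding term_eq by (simp only: sum_distrib_left[symmetric] sum.distrib) simp
  qed
  also have "\<dots> \<le> real N * (42 / 10 * real S + 11 / 10 * Q * A * (7 * A))"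
    using sum_powr_quarter_le[of S] Q A
    by (intro mult_left_mono add_left_mono) (auto simp: A_def)
  also have "\<dots> = real N * (42 / 10 * real S + 77 / 10 * (Q * A\<^sup>2))"
    by (simp add: power2_eq_square)
  \<comment> \<open>These constants are 18 and 56 divided by \<open>3 * sqrt 2\<close>. The first
    comparison is tight, 4.2 against about 4.24; the second is 7.7 against about 13.2.\<close>
  also have "\<dots> \<le> real N * (6 / sqrt 2 * real S + 56 / (3 * sqrt 2) * (Q * A\<^sup>2))"
  proof (intro mult_left_mono add_mono mult_right_mono)
    have sqrt2: "sqrt 2 \<le> 10 / 7" by (rule real_le_lsqrt) (auto simp: power2_eq_square)
    then show "42 / 10 \<le> 6 / sqrt 2" "77 / 10 \<le> 56 / (3 * sqrt 2)"
      by (simp_all add: pos_le_divide_eq)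
  qed (use Q in auto)
  also have "\<dots> = real N / (3 * (sqrt 2 * R)) * (18 * R * real S + 56 * (Q * R) * A\<^sup>2)"
    using R by (simp add: field_simps)
  also have "sqrt 2 * R = sqrt (2 * L / (\<nu> * \<mu>))"
    unfolding R_def by (simp flip: real_sqrt_mult)
  also have "56 * (Q * R) * A\<^sup>2 = 56 * sqrt \<Omega> * \<kappa> / sqrt (\<mu> * \<Delta>0 * \<nu> * \<omega>) * 2 powr (real S / 2)"
    using pos by (simp add: Q_def R_def A2 real_sqrt_mult real_sqrt_divide mult_ac)
  finally show ?thesis by (simp only: R_def)
qed

text \<open>The prescribed iteration limit and number of stages are real numbers and have to be
  rounded up to serve as counts. The bounds in their prescribed form are therefore claimed when both
  are integers; the last two conjuncts bound the cost of the rounded run in every case.\<close>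

theorem theorem3:
  fixes X :: "'a::euclidean_space set" and Y :: "'b::euclidean_space set"
    and nX :: "'a \<Rightarrow> real" and nY :: "'b \<Rightarrow> real"
    and K :: "'a \<Rightarrow> 'b" and J :: "'b \<Rightarrow> real"
    and f :: "'a \<Rightarrow> real" and df :: "'a \<Rightarrow> 'a"
    and V :: "'a \<Rightarrow> 'a \<Rightarrow> real" and W :: "'b \<Rightarrow> 'b \<Rightarrow> real"
    and L \<mu> \<nu> \<omega> \<Omega> \<Delta>0 \<epsilon> \<rho>0 :: real
    and y0 :: 'b and v0 vS :: 'a and N0 S nf nK :: nat
    and \<psi> :: "'a \<Rightarrow> real"
  assumes norms: "is_norm nX" "is_norm nY"
    and X: "closed X" "convex X"
    and Y: "closed Y" "convex Y"
    and K: "linear K"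
    and J: "convex_on Y J"
    and f: "convex_on X f" "has_gradient_on f df X" "continuous_on X df"
    and L_mu: "L > 0" "\<mu> > 0"
      "\<And>x u. x \<in> X \<Longrightarrow> u \<in> X \<Longrightarrow>
         \<mu> / 2 * (nX (x - u))\<^sup>2 \<le> f x - lin f df u x \<and>
         f x - lin f df u x \<le> L / 2 * (nX (x - u))\<^sup>2"
    and V: "prox_function nX X \<nu> V"
      "\<And>x u. x \<in> X \<Longrightarrow> u \<in> X \<Longrightarrow> V x u \<le> 1 / 2 * (nX (x - u))\<^sup>2"
    and W: "prox_function nY Y \<omega> W"
    and Omega: "y0 \<in> Y" "bdd_above (W y0 ` Y)" "\<Omega> = (SUP v\<in>Y. W y0 v)"
    and max_attained: "\<And>\<rho> x. \<rho> \<ge> 0 \<Longrightarrow>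
         \<exists>y\<in>Y. \<forall>z\<in>Y. K x \<bullet> z - J z - \<rho> * W y0 z \<le> K x \<bullet> y - J y - \<rho> * W y0 y"
    and psi: "\<psi> = saddle_obj f K J Y"
    and eps: "\<epsilon> > 0"
    and v0: "v0 \<in> X" "\<psi> v0 - (INF x\<in>X. \<psi> x) \<le> \<Delta>0"
    and L_cond: "\<Omega> * (op_norm nX nY K)\<^sup>2 * max (sqrt (15 * \<Delta>0 / \<epsilon>)) 1 \<ge> 2 * \<omega> * \<Delta>0 * L"
    and N0: "N0 = nat \<lceil>3 * sqrt (2 * L / (\<nu> * \<mu>))\<rceil>"
    and S: "S = nat \<lceil>log 2 (max (15 * \<Delta>0 / \<epsilon>) 1)\<rceil>"
    and rho0: "\<rho>0 = 4 * \<Delta>0 / (\<Omega> * 2 powr (real S / 2))"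
    and run: "(vS, nf, nK) =
      ms_ags X V f df (smoothed K J Y W y0) L (\<lambda>\<rho>. (op_norm nX nY K)\<^sup>2 / (\<rho> * \<omega>)) \<nu> \<rho>0 N0 v0 S"
  shows "eps_solution \<psi> X \<epsilon> vS
    \<and> (3 * sqrt (2 * L / (\<nu> * \<mu>)) \<in> \<int> \<and> log 2 (max (15 * \<Delta>0 / \<epsilon>) 1) \<in> \<int> \<longrightarrow>
         real nf \<le> 3 * sqrt (2 * L / (\<nu> * \<mu>)) * log 2 (max (15 * \<Delta>0 / \<epsilon>) 1)
       \<and> real nK \<le> 18 * sqrt (L / (\<nu> * \<mu>)) * log 2 (max (15 * \<Delta>0 / \<epsilon>) 1)
            + 56 * sqrt \<Omega> * op_norm nX nY K / sqrt (\<mu> * \<Delta>0 * \<nu> * \<omega>)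
              * max (sqrt (15 * \<Delta>0 / \<epsilon>)) 1)
    \<and> real nf \<le> real N0 * real S
    \<and> real nK \<le> real N0 / (3 * sqrt (2 * L / (\<nu> * \<mu>)))
         * (18 * sqrt (L / (\<nu> * \<mu>)) * real S
            + 56 * sqrt \<Omega> * op_norm nX nY K / sqrt (\<mu> * \<Delta>0 * \<nu> * \<omega>) * 2 powr (real S / 2))"
proof -
  interpret P: multistage_setting Y nX nY K J W \<omega> y0 X V f df L \<mu> \<nu>
    by (intro multistage_setting.intro saddle_setting.intro multistage_setting_axioms.intro)
      (fact norms K J W Omega(1,2) max_attained X f(2) L_mu V)+
  define m where "m = max (15 * \<Delta>0 / \<epsilon>) 1"
  define \<kappa> where "\<kappa> = op_norm nX nY K"
  define c where "c = 3 * sqrt (2 * L / (\<nu> * \<mu>))"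
  define B where "B t M = 18 * sqrt (L / (\<nu> * \<mu>)) * t
    + 56 * sqrt \<Omega> * \<kappa> / sqrt (\<mu> * \<Delta>0 * \<nu> * \<omega>) * M" for t M
  have \<psi>: "\<psi> x = f x + P.h 0 x" for x
    by (simp add: psi saddle_obj_def smoothed_def)
  have inf_le: "(INF x\<in>X. \<psi> x) \<le> \<psi> z" if "z \<in> X" for z
    using P.bdd_below_problem[OF v0(1)] that by (intro cINF_lower) (simp_all add: \<psi>)
  have \<Delta>0: "0 \<le> \<Delta>0" using inf_le[OF v0(1)] v0(2) by linarith
  have \<Omega>: "0 \<le> \<Omega>" using P.\<Omega>_nonneg by (simp add: Omega(3))
  have \<kappa>: "0 \<le> \<kappa>" unfolding \<kappa>_def by (rule op_norm_nonneg[OF norms K])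
  have pos: "L > 0" "\<nu> > 0" "\<mu> > 0" "\<omega> > 0" using L_mu P.\<nu>_pos P.\<omega>_pos by auto
  have c: "c > 0" using pos by (simp add: c_def)
  have N: "c \<le> real N0" unfolding N0 c_def by (rule real_nat_ceiling_ge)
  have m1: "1 \<le> m" by (simp add: m_def)
  then have log_m: "0 \<le> log 2 m" by simp
  have S': "log 2 m \<le> real S" unfolding S m_def by (rule real_nat_ceiling_ge)
  have "m = 2 powr (log 2 m)" using m1 by simp
  also have "\<dots> \<le> 2 powr (real S)" using S' by (intro powr_mono) auto
  also have "\<dots> = 2 ^ S" by (simp add: powr_realpow)
  finally have m_le: "m \<le> 2 ^ S" .
  \<comment> \<open>This includes \<open>\<Delta>0 = 0\<close>, where the second summand is a
    division by zero and hence 0.\<close>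
  have B_nonneg: "0 \<le> B t M" if "0 \<le> t" "0 \<le> M" for t M
    using that pos \<Delta>0 \<Omega> \<kappa> by (simp add: B_def)
  have runs: "vS = fst (ms_ags X V f df P.h L P.M \<nu> \<rho>0 N0 v0 S)"
    "nf = N0 * S"
    "nK = snd (snd (ms_ags X V f df P.h L P.M \<nu> \<rho>0 N0 v0 S))"
    using ms_ags_gradient_count[of X V f df P.h L P.M \<nu> \<rho>0 N0 v0 S] by (simp_all flip: run)
  have main: "eps_solution \<psi> X \<epsilon> vS \<and> real nK \<le> real N0 / c * B (real S) (2 powr (real S / 2))"
  proof (cases "S = 0")
    \<comment> \<open>The output is \<open>v0\<close>, and \<open>S = 0\<close> means
      \<open>15 * \<Delta>0 \<le> \<epsilon>\<close>, so its initial gap is already small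
      enough.\<close>
    case True
    then have "15 * \<Delta>0 / \<epsilon> \<le> 1" using m_le by (simp add: m_def)
    then have "\<Delta>0 \<le> \<epsilon>" using eps \<Delta>0 by (simp add: field_simps)
    then have "eps_solution \<psi> X \<epsilon> vS" using runs(1) True v0 by (simp add: eps_solution_def)
    moreover have "nK = 0" using runs(3) True by simp
    moreover have "0 \<le> real N0 / c * B (real S) (2 powr (real S / 2))"
      using c by (intro mult_nonneg_nonneg B_nonneg) auto
    ultimately show ?thesis by simp
  next
    case False
    have "m \<noteq> 1"
    proof
      assume "m = 1"
      then show False using False by (simp add: S m_def)
    qed
    then have "15 * \<Delta>0 / \<epsilon> > 1" by (auto simp: m_def max_def split: if_splits)
    then have \<Delta>0': "\<Delta>0 > 0" using eps by (cases "\<Delta>0 = 0") (use \<Delta>0 in auto)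
    have "0 < 2 * \<omega> * \<Delta>0 * L" using pos \<Delta>0' by simp
    then have "0 < \<Omega> * \<kappa>\<^sup>2 * max (sqrt (15 * \<Delta>0 / \<epsilon>)) 1"
      using L_cond unfolding \<kappa>_def by linarith
    then have \<Omega>': "\<Omega> > 0" and \<kappa>': "\<kappa> \<noteq> 0" using \<Omega> by (cases "\<Omega> = 0"; auto)+
    have \<rho>0: "\<rho>0 > 0" using \<Delta>0' \<Omega>' by (simp add: rho0)
    define \<rho>S where "\<rho>S = 2 powr (- (real S / 2)) * \<rho>0"
    have \<rho>S: "\<rho>S > 0" using \<rho>0 by (simp add: \<rho>S_def)
    have "f v0 + P.h 0 v0 - (f z + P.h 0 z) \<le> \<Delta>0" if "z \<in> X" for z
      using inf_le[OF that] v0(2) by (simp add: \<psi>)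
    from P.multistage_gap[OF \<rho>0 \<kappa>'[unfolded \<kappa>_def] v0(1) N[unfolded c_def] this, of S]
    have vS: "vS \<in> X" and gap: "\<And>z. z \<in> X \<Longrightarrow>
        f vS + P.h \<rho>S vS - (f z + P.h \<rho>S z) \<le> \<Delta>0 / 2 ^ S + \<rho>S * \<Omega>"
      by (simp_all add: runs(1) \<rho>S_def Omega(3))
    have \<rho>S\<Omega>: "\<rho>S * \<Omega> = 4 * \<Delta>0 / 2 ^ S"
    proof -
      have "(2::real) powr (real S / 2) * 2 powr (real S / 2) = 2 ^ S"
        by (simp flip: powr_add add: powr_realpow)
      then show ?thesis using \<Omega>' by (simp add: \<rho>S_def rho0 powr_minus_divide)
    qed
    \<comment> \<open>In units of \<open>\<Delta>0 / 2 ^ S\<close>, 9 is 1 + 4 + 4: the halved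
      initial gap, the smoothing term of the invariant, and the price
      \<open>\<rho>S * \<Omega>\<close> of returning from \<open>h \<rho>S\<close> to
      \<open>h 0\<close> at \<open>vS\<close>.\<close>
    have "\<psi> vS - 9 * \<Delta>0 / 2 ^ S \<le> \<psi> z" if "z \<in> X" for z
    proof -
      have "P.h 0 vS \<le> P.h \<rho>S vS + \<rho>S * \<Omega>" "P.h \<rho>S z \<le> P.h 0 z"
        using P.smoothed_antimono[of 0 \<rho>S] \<rho>S by (simp_all add: Omega(3))
      then show ?thesis using gap[OF that] by (simp add: \<psi> \<rho>S\<Omega>)
    qed
    then have "\<psi> vS - 9 * \<Delta>0 / 2 ^ S \<le> (INF z\<in>X. \<psi> z)"
      using vS by (intro cINF_greatest) auto
    moreover have "15 * \<Delta>0 / \<epsilon> \<le> 2 ^ S" using m_le by (simp add: m_def)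
    then have "15 * \<Delta>0 / 2 ^ S \<le> \<epsilon>" using eps by (simp add: field_simps)
    moreover have "9 * \<Delta>0 / 2 ^ S \<le> 15 * \<Delta>0 / 2 ^ S"
      using \<Delta>0 by (intro divide_right_mono) auto
    ultimately have "eps_solution \<psi> X \<epsilon> vS" using vS unfolding eps_solution_def by linarith
    moreover have "real nK \<le> real N0 / c * B (real S) (2 powr (real S / 2))"
    proof -
      have "P.M \<rho> > 0" if "\<rho> > 0" for \<rho> using that pos \<kappa>' by (simp add: \<kappa>_def)
      then have "real nK \<le> (\<Sum>s=1..S. real N0 * (42 / 10 + 22 / 10 *
          sqrt (\<kappa>\<^sup>2 / (2 powr (- (real s / 2)) * \<rho>0 * \<omega>) / L)))"
        unfolding runs(3) \<kappa>_def by (rule ms_ags_operator_count[OF pos(1) _ \<rho>0])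
      also have "\<dots> \<le> real N0 / c * B (real S) (2 powr (real S / 2))"
        unfolding rho0 c_def B_def
        by (rule multistage_operator_count_le[OF pos(1-4) \<Delta>0' \<Omega>' \<kappa>])
      finally show ?thesis .
    qed
    ultimately show ?thesis by blast
  qed
  have int: "real nf \<le> c * log 2 m \<and> real nK \<le> B (log 2 m) (max (sqrt (15 * \<Delta>0 / \<epsilon>)) 1)"
    if ints: "c \<in> \<int>" "log 2 m \<in> \<int>"
  proof -
    \<comment> \<open>For integral values both ceilings are exact. Then \<open>2 powr S = m\<close>,
      and \<open>2 powr (S / 2)\<close> becomes the \<open>max\<close> of the statement.\<close>
    have N0c: "real N0 = c" using ints(1) c unfolding N0 c_def[symmetric] by (auto elim!: Ints_cases)
    have Sm: "real S = log 2 m" using ints(2) log_m unfolding S m_def[symmetric] by (auto elim!: Ints_cases)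
    have "2 powr (real S / 2) = sqrt (2 powr (real S))"
      by (simp add: powr_half_sqrt[symmetric] powr_powr)
    also have "2 powr (real S) = m" using m1 by (simp add: Sm)
    also have "sqrt m = max (sqrt (15 * \<Delta>0 / \<epsilon>)) 1"
      by (simp add: m_def max_def)
    finally have "2 powr (real S / 2) = max (sqrt (15 * \<Delta>0 / \<epsilon>)) 1" .
    then show ?thesis using main c by (simp add: runs(2) N0c Sm)
  qed
  show ?thesis
    using main int unfolding B_def c_def m_def \<kappa>_def runs(2) of_nat_mult by blast
qed

end
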